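(* Let $k$ and $n$ be integers with $1\le k<n$. Let $\pi$ be uniformly random in $S_{b_2}$, let $X_1,\dots,X_{n-k+1}$ be the shifted indicators of the $k$-cycles of $\pi$, let $\sigma^2=\sigma_{n,k}^2=\mathrm{Var}(C_{n,k})$ (with $\sigma>0$), and let $W=\frac1\sigma\sum_{i=1}^{n-k+1}X_i$. Let $Z\sim N(0,1)$. Then $$d_W(W,Z)\le \frac{4k^2}{\sigma^3}\,a_{n,k}+\frac{\sqrt{28}\,(2k)^{3/2}}{\sqrt{\pi}\,\sigma^2}\sqrt{b_{n,k}},$$ where $\pi$ in $\sqrt{\pi}$ is the usual constant. Moreover, for fixed $k$ and $n\to\infty$, one has $\sigma^2=\Theta(n)$, $a_{n,k}=\Theta(n)$ and $b_{n,k}=\Theta(n)$, and therefore the upper bound above is $\Theta(n^{-1/2})$.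
   Context: $S_{b_2}$ is the set of permutations $\pi$ of $\{1,\dots,n\}$ with $\pi(i)\ge i-1$ for all $i\in\{2,\dots,n\}$. $C_{n,k}$ is the number of cycles of length $k$ of $\pi$ (fixed points count as $1$-cycles). Every $k$-cycle of a permutation in $S_{b_2}$ is one of the following $n-k+1$ cycles: for $i=1,\dots,n-k+1$, $I_i^k$ is the cycle on the elements $i,i+1,\dots,i+k-1$ that sends $i\mapsto i+k-1$ and $j\mapsto j-1$ for $i<j\le i+k-1$ (for $k=1$, the fixed point $i$). "$I_i^k$ occurs" means that $I_i^k$ is a cycle of $\pi$. The shifted indicators are $$X_i=\mathbf 1(I_i^k\text{ occurs})-2^{-k}\ \text{ for } i\in\{1,n-k+1\},\qquad X_i=\mathbf 1(I_i^k\text{ occurs})-2^{-(k+1)}\ \text{ for } 2\le i\le n-k.$$ Define $$a_{n,k}=\sum_{i=1}^{n-k+1}\mathbb E|X_i|^3=2\cdot\frac{2^{3k}-3\cdot 2^{2k}+2^{k+2}-2}{2^{4k}}+(n-k-1)\frac{2^{3(k+1)}-3\cdot 2^{2(k+1)}+2^{k+3}-2}{2^{4(k+1)}},$$ $$b_{n,k}=\sum_{i=1}^{n-k+1}\mathbb E[X_i^4]=2\cdot\frac{(2^{2k}-3\cdot 2^{k}+3)(2^k-1)}{2^{4k}}+(n-k-1)\frac{(2^{2(k+1)}-3\cdot 2^{k+1}+3)(2^{k+1}-1)}{2^{4(k+1)}}.$$ The Wasserstein distance between real random variables $W,Z$ is $d_W(W,Z)=\sup_h|\mathbb E h(W)-\mathbb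 E h(Z)|$, the supremum being over all $h:\mathbb R\to\mathbb R$ with $|h(x)-h(y)|\le|x-y|$ for all $x,y$. *)

theory Defs
  imports
    "HOL-Probability.Probability"
    "HOL-Combinatorics.Combinatorics"
    "HOL-Library.Landau_Symbols"
begin

definition S_b2 :: "nat \<Rightarrow> (nat \<Rightarrow> nat) set" where
  "S_b2 n = {\<pi>. \<pi> permutes {1..n} \<and> (\<forall>i\<in>{2..n}. \<pi> i \<ge> i - 1)}"

definition unif_b2 :: "nat \<Rightarrow> (nat \<Rightarrow> nat) pmf" where
  "unif_b2 n = pmf_of_set (S_b2 n)"

(* The cycles of a permutation of {1..n} are counted through their underlying sets, the orbits. *)
definition num_cycles :: "nat \<Rightarrow> nat \<Rightarrow> (nat \<Rightarrow> nat) \<Rightarrow> nat" where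
  "num_cycles n k \<pi> = card {c \<in> orbit \<pi> ` {1..n}. card c = k}"

definition cycle_I :: "nat \<Rightarrow> nat \<Rightarrow> nat \<Rightarrow> nat" where
  "cycle_I k i j = (if j = i then i + k - 1 else if i < j \<and> j \<le> i + k - 1 then j - 1 else j)"

definition occurs_I :: "nat \<Rightarrow> nat \<Rightarrow> (nat \<Rightarrow> nat) \<Rightarrow> bool" where
  "occurs_I k i \<pi> \<longleftrightarrow> (\<forall>j\<in>{i..i + k - 1}. \<pi> j = cycle_I k i j)"

definition shifted_ind :: "nat \<Rightarrow> nat \<Rightarrow> nat \<Rightarrow> (nat \<Rightarrow> nat) \<Rightarrow> real" where
  "shifted_ind n k i \<pi> =
     of_bool (occurs_I k i \<pi>) - (if i \<in> {1, n - k + 1} then 1 / 2 ^ k else 1 / 2 ^ (k + 1))"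

definition sigma_nk :: "nat \<Rightarrow> nat \<Rightarrow> real" where
  "sigma_nk n k = sqrt (measure_pmf.variance (unif_b2 n) (\<lambda>\<pi>. real (num_cycles n k \<pi>)))"

definition W_nk :: "nat \<Rightarrow> nat \<Rightarrow> (nat \<Rightarrow> nat) \<Rightarrow> real" where
  "W_nk n k \<pi> = (1 / sigma_nk n k) * (\<Sum>i=1..n - k + 1. shifted_ind n k i \<pi>)"

definition a_nk :: "nat \<Rightarrow> nat \<Rightarrow> real" where
  "a_nk n k = (\<Sum>i=1..n - k + 1.
     measure_pmf.expectation (unif_b2 n) (\<lambda>\<pi>. \<bar>shifted_ind n k i \<pi>\<bar> ^ 3))"

definition b_nk :: "nat \<Rightarrow> nat \<Rightarrow> real" where
  "b_nk n k = (\<Sum>i=1..n - k + 1.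
     measure_pmf.expectation (unif_b2 n) (\<lambda>\<pi>. shifted_ind n k i \<pi> ^ 4))"

(* The random variables may live on different probability spaces.  Non-integrable functions have
   Bochner integral 0, so the value is the Wasserstein distance only if both random variables have
   finite first moment; then every Lipschitz h is integrable. *)
definition wasserstein_dist ::
    "'a measure \<Rightarrow> ('a \<Rightarrow> real) \<Rightarrow> 'b measure \<Rightarrow> ('b \<Rightarrow> real) \<Rightarrow> ennreal" where
  "wasserstein_dist M X N Y =
     (SUP h\<in>{h :: real \<Rightarrow> real. 1-lipschitz_on UNIV h}.
        ennreal \<bar>(\<integral>x. h (X x) \<partial>M) - (\<integral>y. h (Y y) \<partial>N)\<bar>)"

definition wasserstein_bound :: "nat \<Rightarrow> nat \<Rightarrow> real" where
  "wasserstein_bound n k =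
     4 * real k ^ 2 / sigma_nk n k ^ 3 * a_nk n k
     + sqrt 28 * (2 * real k) powr (3 / 2) / (sqrt pi * sigma_nk n k ^ 2) * sqrt (b_nk n k)"

end

theory Submission
  imports Defs "HOL-Real_Asymp.Real_Asymp"
begin

text \<open>A permutation in \<open>S_b2 n\<close> cuts \<open>{1..n}\<close> into consecutive blocks, each of which is one of its cycles, and
every way of cutting occurs exactly once.  A uniformly random permutation is therefore a sequence of
\<open>n - 1\<close> independent fair coins, coin \<open>m\<close> telling whether a block ends at \<open>m\<close>
(\<open>bij_betw_perm_of\<close>, \<open>unif_b2_eq\<close>), and the number of \<open>k\<close>-cycles is a sum of indicators, the \<open>i\<close>-th of which
depends only on the coins \<open>i - 1, \<dots>, i + k - 1\<close> (\<open>num_cycles_perm_of\<close>).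

The distance to the normal law is bounded by Stein's method.  For every 1-Lipschitz \<open>h\<close> the equation
\<open>f' x - x * f x = h x - E h(Z)\<close> has a solution with \<open>\<bar>f'\<bar> \<le> sqrt (2 / pi)\<close> and \<open>f'\<close> 2-Lipschitz
(\<open>stein_solution_exists\<close>).  Consequently, if \<open>S\<close> is a sum of centred variables \<open>X i\<close> with variance \<open>\<sigma>\<^sup>2\<close>, and
each \<open>X i\<close> is independent of \<open>S - T i\<close>, then the distance of \<open>S / \<sigma>\<close> to the normal law is at most
\<open>(\<Sum>i. E \<bar>X i\<bar> (T i)\<^sup>2) / \<sigma>\<^sup>3 + sqrt (2 / pi) / \<sigma>\<^sup>2 * sqrt (Var (\<Sum>i. X i * T i))\<close> (\<open>stein_bound_local\<close>).

A block can be dependent on \<open>2 * k\<close> other blocks, so that its dependency neighbourhood has \<open>2 * k + 1\<close>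
elements, and estimates that only use the size of the neighbourhood produce constants in \<open>2 * k + 1\<close>
instead of \<open>2 * k\<close>.  Two features of the blocks make up for this.  Overlapping blocks exclude each
other; and \<open>T i\<close> may be changed by a constant without losing independence.  Take for \<open>T i\<close> the number of
occurring blocks in the neighbourhood of block \<open>i\<close>, minus 1.  If block \<open>i\<close> occurs then \<open>T i\<close>
counts only the two blocks that touch it, and otherwise \<open>\<bar>T i\<bar> \<le> 1\<close> (\<open>T_of_ind_1\<close>, \<open>T_of_ind_0\<close>).  Hence the
variance in the second term is at most half of what the claimed bound allows (\<open>square_le_mom4\<close>), and
the first term is at most the claimed one for \<open>k \<ge> 2\<close> (\<open>remainder_le_mom3\<close>).  For fixed points the first
term can be too large by at most \<open>3 * n / 16\<close> before division by \<open>\<sigma>\<^sup>3\<close> (\<open>remainder_fixed_points\<close>), which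
the room left in the second term absorbs (\<open>stein_rate_bound\<close>).

Two touching blocks share one coin that both need to show a break, so they occur together with twice
the product of their probabilities.  This gives the variance of the cycle count exactly
(\<open>variance_count\<close>); it lies between a constant multiple of \<open>n\<close> and \<open>n\<close>, and the asymptotic
statements follow.\<close>

section \<open>Integrals of the Gaussian density over half-lines\<close>

abbreviation phi :: "real \<Rightarrow> real" where "phi \<equiv> std_normal_density"

definition lower_integral :: "(real \<Rightarrow> real) \<Rightarrow> real \<Rightarrow> real" where
  "lower_integral u w = (LBINT x:{..w}. u x)"

definition upper_integral :: "(real \<Rightarrow> real) \<Rightarrow> real \<Rightarrow> real" where
  "upper_integral u w = (LBINT x:{w<..}. u x)"

lemma set_integrable_of_integrable:
  fixes u :: "real \<Rightarrow> real"
  assumes "integrable lborel u" "A \<in> sets lborel"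
  shows "set_integrable lborel A u"
  unfolding set_integrable_def using assms by (rule integrable_mult_indicator[rotated])

lemma lower_plus_upper:
  assumes "integrable lborel u"
  shows "lower_integral u w + upper_integral u w = (\<integral>x. u x \<partial>lborel)"
proof -
  have "(LBINT x:{..w} \<union> {w<..}. u x) = lower_integral u w + upper_integral u w"
    unfolding lower_integral_def upper_integral_def
    by (rule set_integral_Un) (auto intro: set_integrable_of_integrable assms)
  moreover have "{..w} \<union> {w<..} = UNIV" by auto
  ultimately show ?thesis by (simp add: set_lebesgue_integral_def)
qed

lemma lower_integral_deriv:
  assumes cont: "continuous_on UNIV u" and int: "integrable lborel u"
  shows "(lower_integral u has_real_derivative u w) (at w)"
proof -
  let ?a = "w - 1" and ?b = "w + 1"
  have eq: "lower_integral u v = (LBINT x:{..<?a}. u x) + integral {?a..v} u" if "v \<in> {?a<..<?b}" for v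
  proof -
    have "lower_integral u v = (LBINT x:{..<?a} \<union> {?a..v}. u x)"
      unfolding lower_integral_def using that by (intro arg_cong2[where f="\<lambda>A f. set_lebesgue_integral lborel A f"]) auto
    also have "\<dots> = (LBINT x:{..<?a}. u x) + (LBINT x:{?a..v}. u x)"
      by (rule set_integral_Un) (auto intro: set_integrable_of_integrable int)
    also have "(LBINT x:{?a..v}. u x) = integral {?a..v} u"
      by (intro set_borel_integral_eq_integral set_integrable_of_integrable int) auto
    finally show ?thesis .
  qed
  have "((\<lambda>v. integral {?a..v} u) has_real_derivative u w) (at w within {?a..?b})"
    by (rule integral_has_real_derivative) (auto intro: continuous_on_subset[OF cont])
  then have "((\<lambda>v. integral {?a..v} u) has_real_derivative u w) (at w)"
    by (simp add: at_within_Icc_at)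
  then have "((\<lambda>v. (LBINT x:{..<?a}. u x) + integral {?a..v} u) has_real_derivative u w) (at w)"
    by (auto intro!: derivative_eq_intros)
  then show ?thesis
    by (rule has_field_derivative_transform_within_open[where S="{?a<..<?b}"]) (auto simp: eq)
qed

lemma lower_integral_at_top:
  assumes "integrable lborel u"
  shows "(lower_integral u \<longlongrightarrow> (\<integral>x. u x \<partial>lborel)) at_top"
  using tendsto_integral_at_top[OF _ assms]
  unfolding lower_integral_def set_lebesgue_integral_def by simp

text \<open>The difference of the lower integral and an antiderivative is constant, and the behaviour at infinity
identifies the constant.\<close>

lemma upper_integral_antideriv:
  assumes cont: "continuous_on UNIV u" and int: "integrable lborel u"
    and der: "\<And>x. (V has_real_derivative u x) (at x)" and lim: "(V \<longlongrightarrow> 0) at_top"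
  shows "upper_integral u w = - V w"
proof -
  have "\<forall>x. ((\<lambda>v. lower_integral u v - V v) has_real_derivative 0) (at x)"
    by (auto intro!: derivative_eq_intros lower_integral_deriv[OF cont int] der)
  then have const: "(\<lambda>v. lower_integral u v - V v) = (\<lambda>v. lower_integral u w - V w)"
    by (intro ext DERIV_isconst_all)
  have "((\<lambda>v. lower_integral u v - V v) \<longlongrightarrow> (\<integral>x. u x \<partial>lborel) - 0) at_top"
    by (intro tendsto_intros lower_integral_at_top int lim)
  then have "((\<lambda>v::real. lower_integral u w - V w) \<longlongrightarrow> (\<integral>x. u x \<partial>lborel)) at_top"
    unfolding const by simp
  then have "lower_integral u w - V w = (\<integral>x. u x \<partial>lborel)"
    by (simp add: tendsto_const_iff)
  then show ?thesis using lower_plus_upper[OF int, of w] by simp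
qed

lemma phi_pos: "phi x > 0" by (simp add: normal_density_pos)

lemma phi_deriv: "(phi has_real_derivative (- x * phi x)) (at x)"
proof -
  have "((\<lambda>x. K * exp (- x\<^sup>2 / 2)) has_real_derivative (- x * (K * exp (- x\<^sup>2 / 2)))) (at x)"
    for K :: real
    by (auto intro!: derivative_eq_intros)
  from this[of "1 / sqrt (2 * pi)"] show ?thesis
    unfolding std_normal_density_def[abs_def] .
qed

lemma phi_cont: "continuous_on A phi"
  by (intro continuous_at_imp_continuous_on ballI DERIV_isCont[OF phi_deriv])

lemma phi_integrable: "integrable lborel phi" "integrable lborel (\<lambda>x. x * phi x)"
    "integrable lborel (\<lambda>x. x^2 * phi x)" "integrable lborel (\<lambda>x. \<bar>x\<bar> * phi x)"
  using integrable_std_normal_moment[of 0] integrable_std_normal_moment[of 1]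
    integrable_std_normal_moment[of 2] integrable_std_normal_moment_abs[of 1]
  by (simp_all add: mult.commute)

lemma phi_integral: "(\<integral>x. phi x \<partial>lborel) = 1" "(\<integral>x. x * phi x \<partial>lborel) = 0"
  using integral_std_normal_moment_even[of 0] integral_std_normal_moment_odd[of 0]
  by (simp_all add: mult.commute)

lemma phi_limits: "(phi \<longlongrightarrow> 0) at_top" "((\<lambda>x. x * phi x) \<longlongrightarrow> 0) at_top"
  unfolding std_normal_density_def by real_asymp+

abbreviation Phi :: "real \<Rightarrow> real" where "Phi \<equiv> lower_integral phi"

text \<open>The antiderivatives are \<open>- phi x\<close> for \<open>x * phi x\<close> and \<open>- x * phi x\<close> for \<open>x\<^sup>2 * phi x - phi x\<close>.\<close>

lemma partial_moments:
  shows "upper_integral phi w = 1 - Phi w"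
    and "upper_integral (\<lambda>x. x * phi x) w = phi w"
    and "lower_integral (\<lambda>x. x * phi x) w = - phi w"
    and "upper_integral (\<lambda>x. x^2 * phi x) w = w * phi w + (1 - Phi w)"
proof -
  show 0: "upper_integral phi w = 1 - Phi w"
    using lower_plus_upper[OF phi_integrable(1), of w] by (simp add: phi_integral)
  have "upper_integral (\<lambda>x. x * phi x) w = - (- phi w)"
  proof (rule upper_integral_antideriv)
    show "((\<lambda>x. - phi x) has_real_derivative x * phi x) (at x)" for x
      using DERIV_minus[OF phi_deriv[of x]] by simp
    show "((\<lambda>x. - phi x) \<longlongrightarrow> 0) at_top" using tendsto_minus[OF phi_limits(1)] by simp
  qed (intro continuous_intros phi_cont phi_integrable)+
  then show 1: "upper_integral (\<lambda>x. x * phi x) w = phi w" by simp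
  show "lower_integral (\<lambda>x. x * phi x) w = - phi w"
    using lower_plus_upper[OF phi_integrable(2), of w] by (simp add: phi_integral 1)
  have "upper_integral (\<lambda>x. x^2 * phi x - phi x) w = - (- (w * phi w))"
  proof (rule upper_integral_antideriv)
    show "((\<lambda>x. - (x * phi x)) has_real_derivative x^2 * phi x - phi x) (at x)" for x
      using DERIV_minus[OF DERIV_mult[OF DERIV_ident phi_deriv[of x]]]
      by (simp add: power2_eq_square algebra_simps)
    show "((\<lambda>x. - (x * phi x)) \<longlongrightarrow> 0) at_top" using tendsto_minus[OF phi_limits(2)] by simp
    show "integrable lborel (\<lambda>x. x^2 * phi x - phi x)"
      by (intro Bochner_Integration.integrable_diff phi_integrable)
    show "continuous_on UNIV (\<lambda>x. x^2 * phi x - phi x)" by (intro continuous_intros phi_cont)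
  qed
  moreover have "upper_integral (\<lambda>x. x^2 * phi x - phi x) w
     = upper_integral (\<lambda>x. x^2 * phi x) w - upper_integral phi w"
    unfolding upper_integral_def
    by (rule set_integral_diff) (auto intro: set_integrable_of_integrable phi_integrable)
  ultimately show "upper_integral (\<lambda>x. x^2 * phi x) w = w * phi w + (1 - Phi w)"
    using 0 by simp
qed


lemma phi_second_moment: "(\<integral>x. x^2 * phi x \<partial>lborel) = 1"
  using integral_std_normal_moment_even[of 1] by (simp add: mult.commute)

lemma lower_integral_arith:
  assumes "integrable lborel u" "integrable lborel v"
  shows "lower_integral (\<lambda>x. u x + v x) w = lower_integral u w + lower_integral v w"
    and "lower_integral (\<lambda>x. u x - v x) w = lower_integral u w - lower_integral v w"
    and "lower_integral (\<lambda>x. c * u x) w = c * lower_integral u w"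
  unfolding lower_integral_def
  using assms by (auto intro!: set_integral_add set_integral_diff set_integrable_of_integrable)

lemma upper_integral_arith:
  assumes "integrable lborel u" "integrable lborel v"
  shows "upper_integral (\<lambda>x. u x + v x) w = upper_integral u w + upper_integral v w"
    and "upper_integral (\<lambda>x. u x - v x) w = upper_integral u w - upper_integral v w"
    and "upper_integral (\<lambda>x. c * u x) w = c * upper_integral u w"
  unfolding upper_integral_def
  using assms by (auto intro!: set_integral_add set_integral_diff set_integrable_of_integrable)

lemma lower_integral_mono:
  assumes "integrable lborel u" "integrable lborel v" "\<And>x. x \<le> w \<Longrightarrow> u x \<le> v x"
  shows "lower_integral u w \<le> lower_integral v w"
  unfolding lower_integral_def
  using assms by (intro set_integral_mono set_integrable_of_integrable) auto

lemma upper_integral_mono: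
  assumes "integrable lborel u" "integrable lborel v" "\<And>x. x > w \<Longrightarrow> u x \<le> v x"
  shows "upper_integral u w \<le> upper_integral v w"
  unfolding upper_integral_def
  using assms by (intro set_integral_mono set_integrable_of_integrable) auto

lemma partial_first_moments:
  shows "upper_integral (\<lambda>x. (x - w) * phi x) w = phi w - w * (1 - Phi w)"
    and "lower_integral (\<lambda>x. (w - x) * phi x) w = phi w + w * Phi w"
    and "integrable lborel (\<lambda>x. (x - w) * phi x)"
    and "integrable lborel (\<lambda>x. (w - x) * phi x)"
proof -
  have i: "integrable lborel (\<lambda>x. w * phi x)" by (simp add: phi_integrable)
  show "upper_integral (\<lambda>x. (x - w) * phi x) w = phi w - w * (1 - Phi w)"
    using upper_integral_arith(2)[OF phi_integrable(2) i, of w] upper_integral_arith(3)[OF phi_integrable(1,1), of w w]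
    by (simp add: algebra_simps partial_moments)
  show "lower_integral (\<lambda>x. (w - x) * phi x) w = phi w + w * Phi w"
    using lower_integral_arith(2)[OF i phi_integrable(2), of w] lower_integral_arith(3)[OF phi_integrable(1,1), of w w]
    by (simp add: algebra_simps partial_moments)
  show "integrable lborel (\<lambda>x. (x - w) * phi x)"
    using Bochner_Integration.integrable_diff[OF phi_integrable(2) i] by (simp add: algebra_simps)
  show "integrable lborel (\<lambda>x. (w - x) * phi x)"
    using Bochner_Integration.integrable_diff[OF i phi_integrable(2)] by (simp add: algebra_simps)
qed

lemma partial_first_moments_nonneg: "phi w - w * (1 - Phi w) \<ge> 0" "phi w + w * Phi w \<ge> 0"
  using upper_integral_mono[of "\<lambda>x. 0" "\<lambda>x. (x - w) * phi x" w]
    lower_integral_mono[of "\<lambda>x. 0" "\<lambda>x. (w - x) * phi x" w]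
  by (auto simp: partial_first_moments less_imp_le upper_integral_def[of "\<lambda>x. 0"] lower_integral_def[of "\<lambda>x. 0"]
     set_lebesgue_integral_def)

text \<open>Both are integrals of the nonnegative function \<open>(x - w)\<^sup>2 * phi x\<close> over a half-line with end point \<open>w\<close>,
written out with the partial moments.\<close>

lemma mills_ratio:
  shows "w * phi w \<le> (1 + w^2) * (1 - Phi w)" and "- w * phi w \<le> (1 + w^2) * Phi w"
proof -
  let ?u = "\<lambda>x. x^2 * phi x + (- 2 * w) * (x * phi x)" let ?v = "\<lambda>x. w^2 * phi x"
  have eq: "(x - w)^2 * phi x = ?u x + ?v x" for x by (simp add: power2_eq_square algebra_simps)
  have i1: "integrable lborel (\<lambda>x. (- 2 * w) * (x * phi x))" using phi_integrable by simp
  have iu: "integrable lborel ?u" by (intro Bochner_Integration.integrable_add phi_integrable(3) i1)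
  have iv: "integrable lborel ?v" using phi_integrable by simp
  have iuv: "integrable lborel (\<lambda>x. ?u x + ?v x)" by (intro Bochner_Integration.integrable_add iu iv)
  have nn: "0 \<le> ?u x + ?v x" for x unfolding eq[symmetric] by (simp add: less_imp_le)
  have "0 \<le> upper_integral (\<lambda>x. ?u x + ?v x) w"
    using upper_integral_mono[OF _ iuv nn, of w] by (simp add: upper_integral_def[of "\<lambda>x. 0"] set_lebesgue_integral_def)
  also have "\<dots> = (w * phi w + (1 - Phi w)) + (-2 * w) * phi w + w^2 * (1 - Phi w)"
    by (simp only: upper_integral_arith(1)[OF iu iv] upper_integral_arith(1)[OF phi_integrable(3) i1]
        upper_integral_arith(3)[OF phi_integrable(2,2)] upper_integral_arith(3)[OF phi_integrable(1,1)]
        partial_moments)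
  finally show "w * phi w \<le> (1 + w^2) * (1 - Phi w)" by (simp add: algebra_simps)
  have "0 \<le> lower_integral (\<lambda>x. ?u x + ?v x) w"
    using lower_integral_mono[OF _ iuv nn, of w] by (simp add: lower_integral_def[of "\<lambda>x. 0"] set_lebesgue_integral_def)
  also have "\<dots> = lower_integral (\<lambda>x. x^2 * phi x) w + (-2 * w) * (- phi w) + w^2 * Phi w"
    by (simp only: lower_integral_arith(1)[OF iu iv] lower_integral_arith(1)[OF phi_integrable(3) i1]
        lower_integral_arith(3)[OF phi_integrable(2,2)] lower_integral_arith(3)[OF phi_integrable(1,1)]
        partial_moments)
  also have "lower_integral (\<lambda>x. x^2 * phi x) w = Phi w - w * phi w"
    using lower_plus_upper[OF phi_integrable(3), of w] by (simp add: phi_second_moment partial_moments)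
  finally show "- w * phi w \<le> (1 + w^2) * Phi w" by (simp add: algebra_simps)
qed

lemma phi_even: "phi (- x) = phi x" by (simp add: std_normal_density_def)

text \<open>Reflection at the origin exchanges the two half-lines and preserves the density.\<close>

lemma Phi_zero: "Phi 0 = 1 / 2"
proof -
  have "Phi 0 = (\<integral>x. indicator {..0} x * phi x \<partial>lborel)"
    by (simp add: lower_integral_def set_lebesgue_integral_def)
  also have "\<dots> = (\<integral>x. indicator {..0} (- x) * phi (- x) \<partial>lborel)"
    using lborel_integral_real_affine[of "-1" "\<lambda>x. indicator {..0} x * phi x" 0] by simp
  also have "\<dots> = (\<integral>x. indicator {0<..} x * phi x \<partial>lborel)"
  proof (rule integral_cong_AE)
    show "AE x in lborel. indicator {..0} (- x) * phi (- x) = indicator {0<..} x * phi x"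
      using AE_lborel_singleton[of 0] by eventually_elim (auto simp: phi_even indicator_def)
  qed auto
  also have "\<dots> = 1 - Phi 0"
    using partial_moments(1)[of 0] by (simp add: upper_integral_def set_lebesgue_integral_def)
  finally show ?thesis by simp
qed

lemma Phi_deriv: "(Phi has_real_derivative phi w) (at w)"
  by (rule lower_integral_deriv[OF phi_cont phi_integrable(1)])

lemma Phi_minus: "Phi (- w) = 1 - Phi w"
proof -
  have "\<forall>x. ((\<lambda>w. Phi w + Phi (- w)) has_real_derivative 0) (at x)"
  proof
    fix x
    have "((\<lambda>w. Phi (- w)) has_real_derivative phi (-x) * (-1)) (at x)"
      by (rule DERIV_chain2[OF Phi_deriv]) (auto intro!: derivative_eq_intros)
    from DERIV_add[OF Phi_deriv this] show "((\<lambda>w. Phi w + Phi (- w)) has_real_derivative 0) (at x)"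
      by (simp add: phi_even)
  qed
  from DERIV_isconst_all[OF this, of w 0] show ?thesis by (simp add: Phi_zero)
qed


section \<open>An inequality for the two tails\<close>

text \<open>The factors are the expectations of \<open>max 0 (w - Z)\<close> and \<open>max 0 (Z - w)\<close> for a standard normal \<open>Z\<close>;
there is equality at \<open>w = 0\<close>, and this is what makes \<open>sqrt (2 / pi)\<close> the right constant in the Stein bound.
With \<open>A = Phi - 1/2\<close> the factors are \<open>phi w + w * A w \<plusminus> w / 2\<close>, so the claim says
\<open>phi w + w * A w \<le> rho w\<close>, where \<open>rho w = sqrt (w\<^sup>2 / 4 + phi 0 * phi w)\<close>.  Equivalently
\<open>D w = (rho w - phi w) / w - A w\<close> is nonnegative.  The sign of the derivative of \<open>D\<close> at \<open>w\<close> is the sign of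
\<open>chi (w\<^sup>2)\<close> for a concave function \<open>chi\<close> with \<open>chi 0 = 0\<close>, so \<open>D\<close> first increases and then decreases.
As it tends to 0 at both ends, it cannot be negative in between.\<close>

lemma tail_product_le_pos:
  assumes w: "w > 0"
  shows "(phi w + w * Phi w) * (phi w - w * (1 - Phi w)) \<le> phi 0 * phi w"
proof -
  define q where "q = phi 0"
  have q: "q > 0" and q2: "q^2 = 1 / (2 * pi)" and phi_q: "phi x = q * exp (- x\<^sup>2 / 2)" for x
    by (auto simp: q_def std_normal_density_def power_divide)
  define A where "A x = Phi x - 1/2" for x
  define rho where "rho x = sqrt (x^2 / 4 + q * phi x)" for x
  define D where "D x = (rho x - phi x) / x - A x" for x
  define chi where "chi t = t / 4 + q^2 * exp (- t / 2) - q^2 * (1 + t / 2)^2" for t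
  have rad_pos: "x^2 / 4 + q * phi x > 0" for x
    using q phi_pos[of x] by (simp add: add_nonneg_pos)
  have rho_pos: "rho x > 0" and rho2: "(rho x)^2 = x^2 / 4 + q * phi x" for x
    using rad_pos[of x] by (auto simp: rho_def less_imp_le)
  have rho_deriv: "(rho has_real_derivative (x / 2 - q * x * phi x) / (2 * rho x)) (at x)" for x
  proof -
    have "((\<lambda>x. x^2 / 4) has_real_derivative x / 2) (at x)"
      by (auto intro!: derivative_eq_intros)
    moreover have "((\<lambda>x. q * phi x) has_real_derivative q * (- x * phi x)) (at x)"
      by (rule DERIV_cmult[OF phi_deriv])
    ultimately have rad: "((\<lambda>x. x^2 / 4 + q * phi x) has_real_derivative x / 2 + q * (- x * phi x)) (at x)"
      by (rule DERIV_add)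
    have "inverse r / 2 * (x / 2 + q * (- x * p)) = (x / 2 - q * x * p) / (2 * r)" if "r > 0" for r p :: real
      using that by (simp add: field_simps)
    from DERIV_cong[OF DERIV_chain2[OF DERIV_real_sqrt[OF rad_pos] rad] this[OF rho_pos[unfolded rho_def]]]
    show ?thesis unfolding rho_def .
  qed
  have A_deriv: "(A has_real_derivative phi x) (at x)" for x
    unfolding A_def using DERIV_diff[OF Phi_deriv DERIV_const] by simp
  have D_deriv: "(D has_real_derivative phi x * (rho x - q * (1 + x^2 / 2)) / (rho x * x^2)) (at x)"
    if "x > 0" for x
  proof -
    have "(D has_real_derivative
        (((x / 2 - q * x * phi x) / (2 * rho x) - (- x * phi x)) * x - (rho x - phi x) * 1) / (x * x) - phi x) (at x)"
      unfolding D_def using that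
      by (intro DERIV_diff DERIV_divide rho_deriv phi_deriv A_deriv DERIV_ident) auto
    also have "(((x / 2 - q * x * phi x) / (2 * rho x) - (- x * phi x)) * x - (rho x - phi x) * 1) / (x * x) - phi x
       = ((x / 2 - q * x * phi x) * x / 2 - (rho x)^2 + rho x * phi x) / (rho x * x^2)"
      using that rho_pos[of x] by (simp add: field_simps power2_eq_square)
    also have "(x / 2 - q * x * phi x) * x / 2 - (rho x)^2 + rho x * phi x = phi x * (rho x - q * (1 + x^2 / 2))"
      unfolding rho2 by (simp add: field_simps power2_eq_square)
    finally show ?thesis .
  qed
  have chi_concave: "concave_on {0..} chi"
  proof (rule f''_le0_imp_concave)
    show "(chi has_real_derivative 1 / 4 - q^2 * exp (- t / 2) / 2 - q^2 * (1 + t / 2)) (at t)" for t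
      unfolding chi_def by (auto intro!: derivative_eq_intros simp: algebra_simps)
    show "((\<lambda>t. 1 / 4 - q^2 * exp (- t / 2) / 2 - q^2 * (1 + t / 2)) has_real_derivative
        q^2 * exp (- t / 2) / 4 - q^2 / 2) (at t)" for t
      by (auto intro!: derivative_eq_intros simp: algebra_simps)
    show "q^2 * exp (- t / 2) / 4 - q^2 / 2 \<le> 0" if "t \<in> {0..}" for t
    proof -
      have "q^2 * exp (- t / 2) \<le> q^2 * 1" using that by (intro mult_left_mono) auto
      then show ?thesis using zero_le_power2[of q] by linarith
    qed
  qed simp
  have rho_chi: "rho x \<ge> q * (1 + x^2 / 2) \<longleftrightarrow> chi (x^2) \<ge> 0" for x
  proof -
    have "q * (1 + x^2 / 2) \<le> rho x \<longleftrightarrow> (q * (1 + x^2 / 2))^2 \<le> (rho x)^2"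
      using q rho_pos[of x] power_mono_iff[of "q * (1 + x^2 / 2)" "rho x" 2] by (simp add: less_imp_le)
    also have "\<dots> \<longleftrightarrow> chi (x^2) \<ge> 0"
      unfolding rho2 chi_def phi_q by (simp add: power_mult_distrib power2_eq_square[of q] ac_simps)
    finally show ?thesis .
  qed
  have chi_scale: "chi s \<ge> s / t * chi t" if "0 \<le> s" "s \<le> t" "t > 0" for s t
  proof -
    have "chi ((1 - s / t) *\<^sub>R 0 + (s / t) *\<^sub>R t) \<ge> (1 - s / t) * chi 0 + (s / t) * chi t"
      using concave_onD[OF chi_concave, of "s / t" 0 t] that by auto
    then show ?thesis using that by (simp add: chi_def)
  qed
  have "D w \<ge> 0"
  proof (rule ccontr)
    assume neg: "\<not> D w \<ge> 0"
    show False
    proof (cases "chi (w^2) \<ge> 0")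
      case True
      have Dle: "D x \<le> D w" if "0 < x" "x \<le> w" for x
      proof (rule DERIV_nonneg_imp_nondecreasing[OF that(2)])
        fix y assume y: "x \<le> y" "y \<le> w"
        with that have "y > 0" by simp
        have "chi (y^2) \<ge> y^2 / w^2 * chi (w^2)" using y \<open>y > 0\<close> w by (intro chi_scale) (auto simp: power_mono)
        then have "chi (y^2) \<ge> 0" using True by (smt (verit) divide_nonneg_nonneg mult_nonneg_nonneg zero_le_power2)
        with rho_chi have "rho y \<ge> q * (1 + y^2 / 2)" by simp
        then have "0 \<le> phi y * (rho y - q * (1 + y^2 / 2)) / (rho y * y^2)"
          using phi_pos[of y] rho_pos[of y] by (intro divide_nonneg_nonneg mult_nonneg_nonneg) (auto simp: less_imp_le)
        with D_deriv[OF \<open>y > 0\<close>] show "\<exists>d. (D has_real_derivative d) (at y) \<and> 0 \<le> d" by blast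
      qed
      \<comment> \<open>To the left of \<open>w\<close> the function \<open>D\<close> is increasing, so it stays below \<open>D w < 0\<close> near 0.  But the
        numerator \<open>N x = x * D x\<close> vanishes at 0 together with its derivative, so \<open>D\<close> tends to 0 there.\<close>
      define N where "N x = rho x - phi x - x * A x" for x
      have rho0: "rho 0 = q" using q by (simp add: rho_def q_def power2_eq_square[symmetric])
      have N0: "N 0 = 0" by (simp add: N_def rho0 q_def)
      have "(N has_real_derivative 0) (at 0)"
        unfolding N_def
        using DERIV_diff[OF DERIV_diff[OF rho_deriv[of 0] phi_deriv[of 0]] DERIV_mult[OF DERIV_ident A_deriv[of 0]]]
        by (simp add: A_def Phi_zero)
      then have "((\<lambda>h. N h / h) \<longlongrightarrow> 0) (at 0)" by (simp add: DERIV_def N0)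
      then have "((\<lambda>h. N h / h) \<longlongrightarrow> 0) (at_right 0)" by (rule tendsto_mono[rotated]) (simp add: at_le)
      moreover have "\<forall>\<^sub>F h in at_right 0. N h / h \<le> D w"
        unfolding eventually_at_right_field
        by (rule exI[of _ w]) (use w Dle in \<open>auto simp: N_def D_def diff_divide_distrib\<close>)
      ultimately have "0 \<le> D w" by (rule tendsto_upperbound) simp
      with neg show False by simp
    next
      case False
      have Dle: "D x \<le> D w" if "w \<le> x" for x
      proof (rule DERIV_nonpos_imp_nonincreasing[OF that])
        fix y assume y: "w \<le> y" "y \<le> x"
        with w have "y > 0" by simp
        have "chi (w^2) \<ge> w^2 / y^2 * chi (y^2)" using y \<open>y > 0\<close> w by (intro chi_scale) (auto simp: power_mono)
        then have "chi (y^2) < 0" using False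
          by (smt (verit) divide_nonneg_nonneg mult_nonneg_nonneg zero_le_power2)
        with rho_chi have "rho y \<le> q * (1 + y^2 / 2)" by (meson linorder_not_less less_imp_le)
        then have "phi y * (rho y - q * (1 + y^2 / 2)) / (rho y * y^2) \<le> 0"
          using phi_pos[of y] rho_pos[of y] by (intro divide_nonpos_nonneg mult_nonneg_nonpos) (auto simp: less_imp_le)
        with D_deriv[OF \<open>y > 0\<close>] show "\<exists>d. (D has_real_derivative d) (at y) \<and> d \<le> 0" by blast
      qed
      \<comment> \<open>To the right of \<open>w\<close> the function \<open>D\<close> is decreasing, but it is bounded below by a function that
        tends to 0, as \<open>rho x \<ge> x / 2\<close>.\<close>
      have "((\<lambda>x. 1/2 - phi x / x - A x) \<longlongrightarrow> 1/2 - 0 - (1 - 1/2)) at_top"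
        unfolding A_def
      proof (intro tendsto_intros)
        show "((\<lambda>x. phi x / x) \<longlongrightarrow> 0) at_top" unfolding std_normal_density_def by real_asymp
        show "(Phi \<longlongrightarrow> 1) at_top" using lower_integral_at_top[OF phi_integrable(1)] by (simp add: phi_integral)
      qed
      moreover have "\<forall>\<^sub>F x in at_top. 1/2 - phi x / x - A x \<le> D w"
        using eventually_ge_at_top[of w]
      proof eventually_elim
        case (elim x)
        have "x / 2 \<le> rho x"
          unfolding rho_def using q phi_pos[of x] by (intro real_le_rsqrt) (simp add: power_divide less_imp_le)
        then have "1/2 - phi x / x - A x \<le> D x" using elim w by (simp add: D_def field_simps)
        also have "\<dots> \<le> D w" using Dle elim by simp
        finally show ?case .
      qed
      ultimately have "1/2 - 0 - (1 - 1/2) \<le> D w" by (rule tendsto_upperbound) simp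
      with neg show False by simp
    qed
  qed
  then have "phi w + w * A w \<le> rho w" using w by (simp add: D_def field_simps)
  moreover have "phi w + w * A w \<ge> 0"
    using partial_first_moments_nonneg[of w] by (simp add: A_def algebra_simps)
  ultimately have "(phi w + w * A w)^2 \<le> (rho w)^2" by (rule power_mono)
  then show ?thesis unfolding rho2 by (simp add: A_def q_def power2_eq_square algebra_simps)
qed


lemma tail_product_le: "(phi w + w * Phi w) * (phi w - w * (1 - Phi w)) \<le> phi 0 * phi w"
proof (cases w "0 :: real" rule: linorder_cases)
  case less
  from tail_product_le_pos[of "- w"] less show ?thesis
    by (simp add: phi_even Phi_minus algebra_simps)
qed (use tail_product_le_pos in \<open>auto simp: Phi_zero\<close>)

section \<open>The Stein equation for Lipschitz functions\<close>

definition gauss_mean :: "(real \<Rightarrow> real) \<Rightarrow> real" where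
  "gauss_mean h = (\<integral>x. h x * phi x \<partial>lborel)"

text \<open>The solution of \<open>f' x - x * f x = h x - gauss_mean h\<close> obtained by variation of constants; among all
solutions it is the one that stays bounded for bounded \<open>h\<close>.\<close>

definition stein_sol :: "(real \<Rightarrow> real) \<Rightarrow> real \<Rightarrow> real" where
  "stein_sol h w = lower_integral (\<lambda>x. (h x - gauss_mean h) * phi x) w / phi w"

lemma integrable_minus_const_phi:
  assumes "integrable lborel (\<lambda>x. h x * phi x)"
  shows "integrable lborel (\<lambda>x. (h x - c) * phi x)"
proof -
  have "integrable lborel (\<lambda>x. h x * phi x - c * phi x)"
    using phi_integrable assms by (intro Bochner_Integration.integrable_diff) auto
  then show ?thesis by (simp add: algebra_simps)
qed

lemma stein_sol_deriv:
  assumes cont: "continuous_on UNIV h" and int: "integrable lborel (\<lambda>x. h x * phi x)"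
  shows "(stein_sol h has_real_derivative w * stein_sol h w + (h w - gauss_mean h)) (at w)"
proof -
  let ?L = "lower_integral (\<lambda>x. (h x - gauss_mean h) * phi x)"
  have "(?L has_real_derivative (h w - gauss_mean h) * phi w) (at w)"
    by (intro lower_integral_deriv integrable_minus_const_phi int continuous_intros cont phi_cont)
  from DERIV_divide[OF this phi_deriv] phi_pos[of w]
  have "((\<lambda>w. ?L w / phi w) has_real_derivative
      ((h w - gauss_mean h) * phi w * phi w - ?L w * (- w * phi w)) / (phi w * phi w)) (at w)"
    by simp
  moreover have "((h w - gauss_mean h) * phi w * phi w - ?L w * (- w * phi w)) / (phi w * phi w)
      = w * (?L w / phi w) + (h w - gauss_mean h)"
    using phi_pos[of w] by (simp add: field_simps)
  ultimately show ?thesis by (simp only: stein_sol_def[abs_def])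
qed

text \<open>The integrand has total integral 0, so the solution can also be computed from the upper half-line.\<close>

lemma stein_sol_upper:
  assumes int: "integrable lborel (\<lambda>x. h x * phi x)"
  shows "stein_sol h w = - upper_integral (\<lambda>x. (h x - gauss_mean h) * phi x) w / phi w"
proof -
  have "(\<integral>x. (h x - gauss_mean h) * phi x \<partial>lborel) = (\<integral>x. h x * phi x - gauss_mean h * phi x \<partial>lborel)"
    by (simp add: algebra_simps)
  also have "\<dots> = gauss_mean h - gauss_mean h * 1"
    using int phi_integrable by (subst Bochner_Integration.integral_diff) (auto simp: gauss_mean_def phi_integral)
  finally have "lower_integral (\<lambda>x. (h x - gauss_mean h) * phi x) w
      = - upper_integral (\<lambda>x. (h x - gauss_mean h) * phi x) w"
    using lower_plus_upper[OF integrable_minus_const_phi[OF int, of "gauss_mean h"], of w] by simp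
  then show ?thesis by (simp add: stein_sol_def)
qed

text \<open>The left-hand side is the derivative of \<open>x * stein_sol h x\<close> at \<open>w\<close>.  If \<open>h\<close> is monotone, then \<open>h w\<close> bounds
\<open>h\<close> from above on the lower and from below on the upper half-line.  Whichever sign
\<open>h w - gauss_mean h\<close> has, one of the two integral formulas for the solution, combined with the
inequality for the Mills ratio on the same side, gives the claim.\<close>

lemma stein_sol_deriv2_mono:
  assumes mono: "mono h" and int: "integrable lborel (\<lambda>x. h x * phi x)"
  shows "(1 + w^2) * stein_sol h w + w * (h w - gauss_mean h) \<le> 0"
proof -
  define g where "g x = h x - gauss_mean h" for x
  have mg: "g x \<le> g y" if "x \<le> y" for x y using mono that by (simp add: g_def mono_def)
  have ig: "integrable lborel (\<lambda>x. g x * phi x)" unfolding g_def by (rule integrable_minus_const_phi[OF int])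
  have ic: "integrable lborel (\<lambda>x. c * phi x)" for c using phi_integrable by simp
  have lo: "stein_sol h w \<le> g w * Phi w / phi w"
  proof -
    have "lower_integral (\<lambda>x. g x * phi x) w \<le> lower_integral (\<lambda>x. g w * phi x) w"
      by (intro lower_integral_mono ig ic mult_right_mono mg) (auto simp: less_imp_le)
    then show ?thesis using phi_pos[of w]
      by (simp add: stein_sol_def g_def[symmetric] lower_integral_arith(3)[OF phi_integrable(1,1)] divide_right_mono)
  qed
  have up: "stein_sol h w \<le> - (g w * (1 - Phi w)) / phi w"
  proof -
    have "upper_integral (\<lambda>x. g x * phi x) w \<ge> upper_integral (\<lambda>x. g w * phi x) w"
      by (intro upper_integral_mono ig ic mult_right_mono mg) (auto simp: less_imp_le)
    then show ?thesis using phi_pos[of w]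
      by (simp add: stein_sol_upper[OF int] g_def[symmetric] upper_integral_arith(3)[OF phi_integrable(1,1)]
          partial_moments divide_right_mono)
  qed
  have "(1 + w^2) * stein_sol h w + w * g w \<le> 0"
  proof (cases "g w \<ge> 0")
    case True
    have "(1 + w^2) * stein_sol h w \<le> (1 + w^2) * (- (g w * (1 - Phi w)) / phi w)"
      by (intro mult_left_mono up) auto
    also have "\<dots> = - (g w * ((1 + w^2) * (1 - Phi w))) / phi w" by simp
    also have "\<dots> \<le> - (g w * (w * phi w)) / phi w"
      using True mills_ratio(1)[of w] phi_pos[of w]
      by (intro divide_right_mono le_imp_neg_le mult_left_mono) (auto simp: less_imp_le)
    also have "\<dots> = - (w * g w)" using phi_pos[of w] by simp
    finally show ?thesis by simp
  next
    case False
    have "(1 + w^2) * stein_sol h w \<le> (1 + w^2) * (g w * Phi w / phi w)"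
      by (intro mult_left_mono lo) auto
    also have "\<dots> = g w * ((1 + w^2) * Phi w) / phi w" by simp
    also have "\<dots> \<le> g w * (- w * phi w) / phi w"
      using False mills_ratio(2)[of w] phi_pos[of w]
      by (intro divide_right_mono mult_left_mono_neg) (auto simp: less_imp_le)
    also have "\<dots> = - (w * g w)" using phi_pos[of w] by simp
    finally show ?thesis by simp
  qed
  then show ?thesis by (simp add: g_def)
qed

lemma lipschitz_integrable_phi:
  assumes "L-lipschitz_on UNIV h"
  shows "integrable lborel (\<lambda>x. h x * phi x)"
proof (rule Bochner_Integration.integrable_bound)
  show "integrable lborel (\<lambda>x. \<bar>h 0\<bar> * phi x + L * (\<bar>x\<bar> * phi x))"
    using phi_integrable by (intro Bochner_Integration.integrable_add) auto
  have "continuous_on UNIV h" using assms by (rule lipschitz_on_continuous_on)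
  then have "h \<in> borel_measurable borel" by (rule borel_measurable_continuous_onI)
  then show "(\<lambda>x. h x * phi x) \<in> borel_measurable lborel" by simp
  show "AE x in lborel. norm (h x * phi x) \<le> norm (\<bar>h 0\<bar> * phi x + L * (\<bar>x\<bar> * phi x))"
  proof (rule AE_I2)
    fix x
    have "\<bar>h x - h 0\<bar> \<le> L * \<bar>x\<bar>" using lipschitz_onD[OF assms, of x 0] by (simp add: dist_real_def)
    then have "\<bar>h x\<bar> \<le> \<bar>h 0\<bar> + L * \<bar>x\<bar>" by linarith
    then have "\<bar>h x\<bar> * phi x \<le> (\<bar>h 0\<bar> + L * \<bar>x\<bar>) * phi x" by (intro mult_right_mono) (simp_all add: less_imp_le)
    moreover have "L \<ge> 0" using assms by (rule lipschitz_on_nonneg)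
    ultimately show "norm (h x * phi x) \<le> norm (\<bar>h 0\<bar> * phi x + L * (\<bar>x\<bar> * phi x))"
      by (simp add: abs_mult algebra_simps)
  qed
qed

text \<open>For the identity function the solution is the constant \<open>- 1\<close>.\<close>

lemma stein_sol_affine:
  assumes int: "integrable lborel (\<lambda>x. h x * phi x)"
  shows "gauss_mean (\<lambda>x. x + c * h x) = c * gauss_mean h"
    and "stein_sol (\<lambda>x. x + c * h x) w = - 1 + c * stein_sol h w"
    and "integrable lborel (\<lambda>x. (x + c * h x) * phi x)"
proof -
  have ich: "integrable lborel (\<lambda>x. c * (h x * phi x))" using int by simp
  have "integrable lborel (\<lambda>x. x * phi x + c * (h x * phi x))"
    by (intro Bochner_Integration.integrable_add phi_integrable(2) ich)
  then show "integrable lborel (\<lambda>x. (x + c * h x) * phi x)" by (simp add: algebra_simps)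
  have "gauss_mean (\<lambda>x. x + c * h x) = (\<integral>x. x * phi x + c * (h x * phi x) \<partial>lborel)"
    unfolding gauss_mean_def by (simp add: algebra_simps)
  also have "\<dots> = c * gauss_mean h"
    by (subst Bochner_Integration.integral_add[OF phi_integrable(2) ich]) (simp add: phi_integral gauss_mean_def)
  finally show m: "gauss_mean (\<lambda>x. x + c * h x) = c * gauss_mean h" .
  have ig: "integrable lborel (\<lambda>x. (h x - gauss_mean h) * phi x)" by (rule integrable_minus_const_phi[OF int])
  then have icg: "integrable lborel (\<lambda>x. c * ((h x - gauss_mean h) * phi x))" by simp
  have "lower_integral (\<lambda>x. (x + c * h x - c * gauss_mean h) * phi x) w
     = lower_integral (\<lambda>x. x * phi x + c * ((h x - gauss_mean h) * phi x)) w"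
    by (simp add: algebra_simps)
  also have "\<dots> = - phi w + c * lower_integral (\<lambda>x. (h x - gauss_mean h) * phi x) w"
    by (simp only: lower_integral_arith(1)[OF phi_integrable(2) icg] lower_integral_arith(3)[OF ig ig]
        partial_moments)
  finally show "stein_sol (\<lambda>x. x + c * h x) w = - 1 + c * stein_sol h w"
    using phi_pos[of w] by (simp add: stein_sol_def m diff_divide_distrib)
qed

text \<open>Both \<open>x + h x\<close> and \<open>x - h x\<close> are monotone, and the linear part contributes exactly \<open>- 1\<close> to the
quantity bounded in \<open>stein_sol_deriv2_mono\<close>.\<close>

lemma stein_sol_deriv2_bound:
  assumes lip: "1-lipschitz_on UNIV h"
  shows "\<bar>(1 + w^2) * stein_sol h w + w * (h w - gauss_mean h)\<bar> \<le> 1"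
proof -
  note int = lipschitz_integrable_phi[OF lip]
  have bound: "c * ((1 + w^2) * stein_sol h w + w * (h w - gauss_mean h)) \<le> 1" if c: "\<bar>c\<bar> = 1" for c
  proof -
    have "mono (\<lambda>x. x + c * h x)"
    proof (rule monoI)
      fix x y :: real assume "x \<le> y"
      then have "\<bar>h x - h y\<bar> \<le> y - x" using lipschitz_onD[OF lip, of x y] by (simp add: dist_real_def)
      then have "\<bar>c * (h x - h y)\<bar> \<le> y - x" using c by (simp add: abs_mult)
      then have "c * (h x - h y) \<le> y - x" by linarith
      then show "x + c * h x \<le> y + c * h y" by (simp add: algebra_simps)
    qed
    from stein_sol_deriv2_mono[OF this stein_sol_affine(3)[OF int], of w]
    show ?thesis by (simp add: stein_sol_affine[OF int] algebra_simps power2_eq_square)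
  qed
  from bound[of 1] bound[of "-1"] show ?thesis by (simp add: abs_le_iff)
qed

text \<open>Subtracting the constant \<open>h w\<close> from \<open>h\<close> changes neither the solution nor the quantity to be bounded, and leaves a
function that is bounded by \<open>\<bar>x - w\<bar>\<close>.  The derivative at \<open>w\<close> is then a linear combination, with
coefficients of equal sign, of the integrals of this function over the two half-lines, so its absolute
value is largest for \<open>\<bar>x - w\<bar>\<close> itself.  The value there is controlled by \<open>tail_product_le\<close>.\<close>

lemma stein_sol_deriv_bound:
  assumes lip: "1-lipschitz_on UNIV h"
  shows "\<bar>w * stein_sol h w + (h w - gauss_mean h)\<bar> \<le> sqrt (2 / pi)"
proof -
  define k where "k x = h x - h w" for x
  note int = lipschitz_integrable_phi[OF lip]
  have ik: "integrable lborel (\<lambda>x. k x * phi x)" unfolding k_def by (rule integrable_minus_const_phi[OF int])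
  define L R where "L = lower_integral (\<lambda>x. k x * phi x) w" and "R = upper_integral (\<lambda>x. k x * phi x) w"
  define a b where "a = phi w + w * Phi w" and "b = phi w - w * (1 - Phi w)"
  have ab: "a \<ge> 0" "b \<ge> 0" using partial_first_moments_nonneg[of w] by (auto simp: a_def b_def)
  have k_le: "\<bar>k x\<bar> \<le> \<bar>w - x\<bar>" for x
    using lipschitz_onD[OF lip, of x w] by (simp add: dist_real_def k_def)
  have inu: "integrable lborel (\<lambda>x. - u x)" if "integrable lborel u" for u :: "real \<Rightarrow> real"
    using that by simp
  have L: "\<bar>L\<bar> \<le> a"
  proof -
    have kx: "\<bar>k x * phi x\<bar> \<le> (w - x) * phi x" if "x \<le> w" for x
      using k_le[of x] that by (auto simp: abs_mult intro!: mult_right_mono)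
    have "L \<le> lower_integral (\<lambda>x. (w - x) * phi x) w" unfolding L_def
      using kx by (intro lower_integral_mono ik partial_first_moments) (meson abs_le_D1)
    moreover have "lower_integral (\<lambda>x. - (k x * phi x)) w \<le> lower_integral (\<lambda>x. (w - x) * phi x) w"
      using kx by (intro lower_integral_mono inu ik partial_first_moments) (meson abs_le_D2)
    ultimately show ?thesis
      using lower_integral_arith(3)[OF ik ik, of "-1" w]
      by (simp add: partial_first_moments a_def L_def)
  qed
  have R: "\<bar>R\<bar> \<le> b"
  proof -
    have kx: "\<bar>k x * phi x\<bar> \<le> (x - w) * phi x" if "x > w" for x
      using k_le[of x] that by (auto simp: abs_mult intro!: mult_right_mono)
    have "R \<le> upper_integral (\<lambda>x. (x - w) * phi x) w" unfolding R_def
      using kx by (intro upper_integral_mono ik partial_first_moments) (meson abs_le_D1)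
    moreover have "upper_integral (\<lambda>x. - (k x * phi x)) w \<le> upper_integral (\<lambda>x. (x - w) * phi x) w"
      using kx by (intro upper_integral_mono inu ik partial_first_moments) (meson abs_le_D2)
    ultimately show ?thesis
      using upper_integral_arith(3)[OF ik ik, of "-1" w]
      by (simp add: partial_first_moments b_def R_def)
  qed
  have "(\<integral>x. k x * phi x \<partial>lborel) = (\<integral>x. h x * phi x - h w * phi x \<partial>lborel)"
    by (simp add: k_def algebra_simps)
  also have "\<dots> = gauss_mean h - h w"
    using int phi_integrable by (subst Bochner_Integration.integral_diff) (auto simp: gauss_mean_def phi_integral)
  finally have LR: "gauss_mean h - h w = L + R"
    using lower_plus_upper[OF ik, of w] by (simp add: L_def R_def)
  have "lower_integral (\<lambda>x. (h x - gauss_mean h) * phi x) w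
     = lower_integral (\<lambda>x. k x * phi x - (L + R) * phi x) w"
    by (simp add: LR[symmetric] k_def algebra_simps)
  also have "\<dots> = L - (L + R) * Phi w"
    using lower_integral_arith(2)[OF ik, of "\<lambda>x. (L + R) * phi x" w]
      lower_integral_arith(3)[OF phi_integrable(1,1), of "L + R" w]
    by (simp add: phi_integrable L_def)
  finally have sol: "stein_sol h w = (L - (L + R) * Phi w) / phi w" by (simp add: stein_sol_def)
  have "w * stein_sol h w + (h w - gauss_mean h) = w * ((L - (L + R) * Phi w) / phi w) - (L + R)"
    using LR sol by simp
  also have "\<dots> = - (b / phi w * L + a / phi w * R)"
    using phi_pos[of w] by (simp add: a_def b_def field_simps)
  finally have "\<bar>w * stein_sol h w + (h w - gauss_mean h)\<bar> = \<bar>b / phi w * L + a / phi w * R\<bar>"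
    by (simp only: abs_minus_cancel)
  also have "\<dots> \<le> b / phi w * \<bar>L\<bar> + a / phi w * \<bar>R\<bar>"
    using ab phi_pos[of w] by (intro order.trans[OF abs_triangle_ineq]) (simp add: abs_mult)
  also have "\<dots> \<le> b / phi w * a + a / phi w * b"
    using ab phi_pos[of w] L R by (intro add_mono mult_left_mono) auto
  also have "\<dots> = 2 * (a * b) / phi w" by simp
  also have "\<dots> \<le> 2 * (phi 0 * phi w) / phi w"
    using tail_product_le[of w] phi_pos[of w] by (intro divide_right_mono mult_left_mono) (auto simp: a_def b_def less_imp_le)
  also have "\<dots> = 2 * phi 0" using phi_pos[of w] by simp
  also have "\<dots> = sqrt (2 / pi)"
    by (simp add: std_normal_density_def real_sqrt_divide real_sqrt_mult field_simps)
  finally show ?thesis .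
qed

text \<open>The derivative of the solution is \<open>x * f x\<close> plus \<open>h x\<close> up to a constant, and either summand is
1-Lipschitz.  This avoids any second derivative of \<open>f\<close>, which need not exist for Lipschitz \<open>h\<close>.\<close>

theorem stein_solution_exists:
  assumes lip: "1-lipschitz_on UNIV h"
  obtains f f' :: "real \<Rightarrow> real" where
    "\<And>x. (f has_real_derivative f' x) (at x)"
    "\<And>x. f' x - x * f x = h x - gauss_mean h"
    "\<And>x. \<bar>f' x\<bar> \<le> sqrt (2 / pi)"
    "\<And>x y. \<bar>f' x - f' y\<bar> \<le> 2 * \<bar>x - y\<bar>"
proof -
  let ?f = "stein_sol h" and ?f' = "\<lambda>x. x * stein_sol h x + (h x - gauss_mean h)"
  note int = lipschitz_integrable_phi[OF lip]
  have deriv: "(?f has_real_derivative ?f' x) (at x)" for x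
    by (rule stein_sol_deriv[OF lipschitz_on_continuous_on[OF lip] int])
  have deriv2: "((\<lambda>x. x * stein_sol h x) has_real_derivative
      (1 + x^2) * stein_sol h x + x * (h x - gauss_mean h)) (at x)" for x
    using DERIV_mult[OF DERIV_ident deriv[of x]] by (simp add: algebra_simps power2_eq_square)
  have "\<bar>?f' x - ?f' y\<bar> \<le> 2 * \<bar>x - y\<bar>" for x y
  proof -
    have "\<bar>x * stein_sol h x - y * stein_sol h y\<bar> \<le> 1 * \<bar>x - y\<bar>"
      unfolding real_norm_def[symmetric]
      by (rule field_differentiable_bound[OF convex_UNIV])
         (use deriv2 stein_sol_deriv2_bound[OF lip] in auto)
    moreover have "\<bar>h x - h y\<bar> \<le> \<bar>x - y\<bar>" using lipschitz_onD[OF lip, of x y] by (simp add: dist_real_def)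
    ultimately have "\<bar>(x * stein_sol h x - y * stein_sol h y) + (h x - h y)\<bar> \<le> 2 * \<bar>x - y\<bar>"
      by (intro order.trans[OF abs_triangle_ineq]) simp
    then show ?thesis by (simp add: algebra_simps)
  qed
  moreover have "?f' x - x * ?f x = h x - gauss_mean h" for x by simp
  ultimately show ?thesis using that[of ?f ?f'] deriv stein_sol_deriv_bound[OF lip] by blast
qed

section \<open>Normal approximation under local dependence\<close>

lemma integrable_finite_pmf:
  fixes f :: "'a \<Rightarrow> real"
  assumes "finite (set_pmf P)"
  shows "integrable (measure_pmf P) f"
  by (rule integrable_measure_pmf_finite[OF assms])

lemma expectation_abs_le_sqrt:
  fixes P :: "'a pmf" and U :: "'a \<Rightarrow> real"
  assumes fin: "finite (set_pmf P)"
  shows "measure_pmf.expectation P (\<lambda>\<omega>. \<bar>U \<omega>\<bar>) \<le> sqrt (measure_pmf.expectation P (\<lambda>\<omega>. (U \<omega>)^2))"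
proof (rule real_le_rsqrt)
  note [simp] = integrable_finite_pmf[OF fin]
  have "measure_pmf.variance P (\<lambda>\<omega>. \<bar>U \<omega>\<bar>) \<ge> 0" by (rule measure_pmf.variance_positive)
  then show "(measure_pmf.expectation P (\<lambda>\<omega>. \<bar>U \<omega>\<bar>))^2 \<le> measure_pmf.expectation P (\<lambda>\<omega>. (U \<omega>)^2)"
    by (simp add: measure_pmf.variance_eq)
qed

text \<open>A mean value argument would lose a factor 2.  Instead, \<open>c * (f x - f a - (x - a) * f' a) - (x - a)\<^sup>2\<close> with
\<open>c = \<plusminus> 1\<close> has its maximum at \<open>a\<close>.\<close>

lemma taylor_remainder_lipschitz_deriv:
  fixes f f' :: "real \<Rightarrow> real"
  assumes deriv: "\<And>x. (f has_real_derivative f' x) (at x)"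
    and lip: "\<And>x y. \<bar>f' x - f' y\<bar> \<le> 2 * \<bar>x - y\<bar>"
  shows "\<bar>f b - f a - (b - a) * f' a\<bar> \<le> (b - a)^2"
proof -
  have bound: "c * (f b - f a - (b - a) * f' a) - (b - a)^2 \<le> 0" if c: "\<bar>c\<bar> = 1" for c
  proof -
    define q where "q x = c * (f x - f a - (x - a) * f' a) - (x - a)^2" for x
    define q' where "q' x = c * (f' x - f' a) - 2 * (x - a)" for x
    have q: "(q has_real_derivative q' x) (at x)" for x
      unfolding q_def q'_def by (auto intro!: derivative_eq_intros deriv simp: algebra_simps)
    have c_le: "\<bar>c * (f' x - f' a)\<bar> \<le> 2 * \<bar>x - a\<bar>" for x
      using lip[of x a] c by (simp add: abs_mult)
    have "q b \<le> q a"
    proof (cases "a \<le> b")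
      case True
      show ?thesis
      proof (rule DERIV_nonpos_imp_nonincreasing[OF True])
        fix x assume "a \<le> x" "x \<le> b"
        then have "q' x \<le> 0" using c_le[of x] by (simp add: q'_def abs_le_iff)
        then show "\<exists>y. (q has_real_derivative y) (at x) \<and> y \<le> 0" using q by blast
      qed
    next
      case False
      then have "b \<le> a" by simp
      then show ?thesis
      proof (rule DERIV_nonneg_imp_nondecreasing)
        fix x assume "b \<le> x" "x \<le> a"
        then have "q' x \<ge> 0" using c_le[of x] by (simp add: q'_def abs_le_iff)
        then show "\<exists>y. (q has_real_derivative y) (at x) \<and> 0 \<le> y" using q by blast
      qed
    qed
    then show ?thesis by (simp add: q_def)
  qed
  from bound[of 1] bound[of "-1"] show ?thesis by (simp add: abs_le_iff)
qed

text \<open>Write \<open>W\<close> for the normalised sum.  Because \<open>X i\<close> is centred and independent of \<open>W' i = W - T i / \<sigma>\<close>, the term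
\<open>E (W * f W)\<close> of the Stein equation only involves the increments \<open>f W - f (W' i)\<close>.  Their linear parts
sum to \<open>f' W\<close> times the sum of the \<open>X i * T i\<close>, divided by \<open>\<sigma>\<^sup>2\<close>; this factor has mean 1 and its
fluctuation gives the second summand of the bound.  The Taylor remainders give the first.
The assumption \<open>indep\<close> is insensitive to adding a constant to \<open>T i\<close>, which leaves a choice that affects
the bound.\<close>

theorem stein_bound_local:
  fixes P :: "'a pmf" and X T :: "'i \<Rightarrow> 'a \<Rightarrow> real" and \<sigma> :: real
  assumes fin: "finite (set_pmf P)" and I: "finite I" and \<sigma>: "\<sigma> > 0"
    and indep: "\<And>i u. i \<in> I \<Longrightarrow> measure_pmf.expectation P (\<lambda>\<omega>. X i \<omega> * u ((\<Sum>j\<in>I. X j \<omega>) - T i \<omega>)) = 0"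
    and cov: "measure_pmf.expectation P (\<lambda>\<omega>. \<Sum>i\<in>I. X i \<omega> * T i \<omega>) = \<sigma>^2"
    and lip: "1-lipschitz_on UNIV h"
  shows "\<bar>measure_pmf.expectation P (\<lambda>\<omega>. h (1 / \<sigma> * (\<Sum>i\<in>I. X i \<omega>))) - gauss_mean h\<bar>
    \<le> (\<Sum>i\<in>I. measure_pmf.expectation P (\<lambda>\<omega>. \<bar>X i \<omega>\<bar> * (T i \<omega>)^2)) / \<sigma>^3
      + sqrt (2 / pi) / \<sigma>^2 * sqrt (measure_pmf.variance P (\<lambda>\<omega>. \<Sum>i\<in>I. X i \<omega> * T i \<omega>))"
proof -
  note [simp] = integrable_finite_pmf[OF fin]
  let ?E = "measure_pmf.expectation P"
  obtain f f' where deriv: "\<And>x. (f has_real_derivative f' x) (at x)"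
    and eq: "\<And>x. f' x - x * f x = h x - gauss_mean h"
    and f'_le: "\<And>x. \<bar>f' x\<bar> \<le> sqrt (2 / pi)"
    and f'_lip: "\<And>x y. \<bar>f' x - f' y\<bar> \<le> 2 * \<bar>x - y\<bar>"
    using stein_solution_exists[OF lip] by metis
  define S where "S \<omega> = (\<Sum>i\<in>I. X i \<omega>)" for \<omega>
  define W where "W \<omega> = 1 / \<sigma> * S \<omega>" for \<omega>
  define W' where "W' i \<omega> = 1 / \<sigma> * (S \<omega> - T i \<omega>)" for i \<omega>
  define r where "r i \<omega> = f (W' i \<omega>) - f (W \<omega>) - (W' i \<omega> - W \<omega>) * f' (W \<omega>)" for i \<omega>
  define Y where "Y \<omega> = (\<Sum>i\<in>I. X i \<omega> * T i \<omega>)" for \<omega>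
  have diff: "W' i \<omega> - W \<omega> = - T i \<omega> / \<sigma>" for i \<omega>
    using \<sigma> by (simp add: W_def W'_def field_simps)
  have r_le: "\<bar>r i \<omega>\<bar> \<le> (T i \<omega>)^2 / \<sigma>^2" for i \<omega>
    using taylor_remainder_lipschitz_deriv[OF deriv f'_lip, where b="W' i \<omega>" and a="W \<omega>"]
    by (simp add: r_def diff power_divide)
  have point: "h (W \<omega>) - gauss_mean h = f' (W \<omega>) * (1 - Y \<omega> / \<sigma>^2)
      + (\<Sum>i\<in>I. X i \<omega> * r i \<omega>) / \<sigma> - (\<Sum>i\<in>I. X i \<omega> * f (W' i \<omega>)) / \<sigma>" for \<omega>
  proof -
    have "X i \<omega> * r i \<omega> = X i \<omega> * f (W' i \<omega>) - X i \<omega> * f (W \<omega>) + X i \<omega> * T i \<omega> * (f' (W \<omega>) / \<sigma>)" for i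
      by (simp add: r_def diff field_simps)
    then have "(\<Sum>i\<in>I. X i \<omega> * r i \<omega>) = (\<Sum>i\<in>I. X i \<omega> * f (W' i \<omega>)) - S \<omega> * f (W \<omega>) + Y \<omega> * (f' (W \<omega>) / \<sigma>)"
      by (simp add: sum.distrib sum_subtractf S_def Y_def sum_distrib_right sum_divide_distrib)
    then have "(\<Sum>i\<in>I. X i \<omega> * r i \<omega>) / \<sigma> - (\<Sum>i\<in>I. X i \<omega> * f (W' i \<omega>)) / \<sigma>
        = - W \<omega> * f (W \<omega>) + Y \<omega> / \<sigma>^2 * f' (W \<omega>)"
      by (simp add: W_def add_divide_distrib diff_divide_distrib power2_eq_square)
    then show ?thesis unfolding eq[symmetric] by (simp add: algebra_simps)
  qed
  have zero: "?E (\<lambda>\<omega>. (\<Sum>i\<in>I. X i \<omega> * f (W' i \<omega>)) / \<sigma>) = 0"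
  proof -
    have "?E (\<lambda>\<omega>. X i \<omega> * f (W' i \<omega>)) = 0" if "i \<in> I" for i
      using indep[OF that, of "\<lambda>x. f (1 / \<sigma> * x)"] by (simp add: W'_def S_def)
    then show ?thesis by simp
  qed
  have "?E (\<lambda>\<omega>. h (W \<omega>)) - gauss_mean h = ?E (\<lambda>\<omega>. h (W \<omega>) - gauss_mean h)" by simp
  also have "\<dots> = ?E (\<lambda>\<omega>. f' (W \<omega>) * (1 - Y \<omega> / \<sigma>^2)) + ?E (\<lambda>\<omega>. (\<Sum>i\<in>I. X i \<omega> * r i \<omega>) / \<sigma>)"
    unfolding point using zero by simp
  finally have main: "?E (\<lambda>\<omega>. h (W \<omega>)) - gauss_mean h = \<dots>" .
  have "\<bar>?E (\<lambda>\<omega>. f' (W \<omega>) * (1 - Y \<omega> / \<sigma>^2))\<bar> \<le> ?E (\<lambda>\<omega>. \<bar>f' (W \<omega>) * (1 - Y \<omega> / \<sigma>^2)\<bar>)"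
    by (rule integral_abs_bound)
  also have "\<dots> \<le> ?E (\<lambda>\<omega>. sqrt (2 / pi) / \<sigma>^2 * \<bar>Y \<omega> - \<sigma>^2\<bar>)"
  proof (rule integral_mono)
    fix \<omega>
    have "\<bar>1 - Y \<omega> / \<sigma>^2\<bar> = \<bar>(\<sigma>^2 - Y \<omega>) / \<sigma>^2\<bar>" using \<sigma> by (simp add: diff_divide_distrib)
    also have "\<dots> = \<bar>Y \<omega> - \<sigma>^2\<bar> / \<sigma>^2" by (simp add: abs_minus_commute)
    finally show "\<bar>f' (W \<omega>) * (1 - Y \<omega> / \<sigma>^2)\<bar> \<le> sqrt (2 / pi) / \<sigma>^2 * \<bar>Y \<omega> - \<sigma>^2\<bar>"
      using mult_right_mono[OF f'_le[of "W \<omega>"], of "\<bar>Y \<omega> - \<sigma>^2\<bar> / \<sigma>^2"] by (simp add: abs_mult)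
  qed simp_all
  also have "\<dots> = sqrt (2 / pi) / \<sigma>^2 * ?E (\<lambda>\<omega>. \<bar>Y \<omega> - \<sigma>^2\<bar>)" by simp
  also have "\<dots> \<le> sqrt (2 / pi) / \<sigma>^2 * sqrt (?E (\<lambda>\<omega>. (Y \<omega> - \<sigma>^2)^2))"
    by (intro mult_left_mono expectation_abs_le_sqrt fin) auto
  also have "?E (\<lambda>\<omega>. (Y \<omega> - \<sigma>^2)^2) = measure_pmf.variance P Y"
    using cov by (simp only: Y_def[abs_def])
  finally have 1: "\<bar>?E (\<lambda>\<omega>. f' (W \<omega>) * (1 - Y \<omega> / \<sigma>^2))\<bar> \<le> sqrt (2 / pi) / \<sigma>^2 * sqrt (measure_pmf.variance P Y)" .
  have "\<bar>?E (\<lambda>\<omega>. (\<Sum>i\<in>I. X i \<omega> * r i \<omega>) / \<sigma>)\<bar> \<le> ?E (\<lambda>\<omega>. \<bar>(\<Sum>i\<in>I. X i \<omega> * r i \<omega>) / \<sigma>\<bar>)"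
    by (rule integral_abs_bound)
  also have "\<dots> \<le> ?E (\<lambda>\<omega>. (\<Sum>i\<in>I. \<bar>X i \<omega>\<bar> * (T i \<omega>)^2) / \<sigma>^3)"
  proof (rule integral_mono)
    fix \<omega>
    have "\<bar>\<Sum>i\<in>I. X i \<omega> * r i \<omega>\<bar> \<le> (\<Sum>i\<in>I. \<bar>X i \<omega>\<bar> * ((T i \<omega>)^2 / \<sigma>^2))"
      by (intro order.trans[OF sum_abs] sum_mono) (simp add: abs_mult mult_left_mono r_le del: times_divide_eq_right)
    then have "\<bar>\<Sum>i\<in>I. X i \<omega> * r i \<omega>\<bar> / \<sigma> \<le> (\<Sum>i\<in>I. \<bar>X i \<omega>\<bar> * ((T i \<omega>)^2 / \<sigma>^2)) / \<sigma>"
      using \<sigma> by (intro divide_right_mono) auto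
    also have "\<dots> = (\<Sum>i\<in>I. \<bar>X i \<omega>\<bar> * (T i \<omega>)^2) / \<sigma>^3"
      by (simp add: sum_divide_distrib power2_eq_square power3_eq_cube)
    finally show "\<bar>(\<Sum>i\<in>I. X i \<omega> * r i \<omega>) / \<sigma>\<bar> \<le> (\<Sum>i\<in>I. \<bar>X i \<omega>\<bar> * (T i \<omega>)^2) / \<sigma>^3"
      using \<sigma> by simp
  qed simp_all
  also have "\<dots> = (\<Sum>i\<in>I. ?E (\<lambda>\<omega>. \<bar>X i \<omega>\<bar> * (T i \<omega>)^2)) / \<sigma>^3" by simp
  finally have 2: "\<bar>?E (\<lambda>\<omega>. (\<Sum>i\<in>I. X i \<omega> * r i \<omega>) / \<sigma>)\<bar> \<le> \<dots>" .
  from main 1 2 abs_triangle_ineq[of "?E (\<lambda>\<omega>. f' (W \<omega>) * (1 - Y \<omega> / \<sigma>^2))" "?E (\<lambda>\<omega>. (\<Sum>i\<in>I. X i \<omega> * r i \<omega>) / \<sigma>)"]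
  show ?thesis unfolding W_def S_def Y_def by linarith
qed

text \<open>Only dependent pairs contribute covariances, and each covariance is at most the average of the two
variances.\<close>

lemma variance_sum_local:
  fixes P :: "'a pmf" and Y :: "'i \<Rightarrow> 'a \<Rightarrow> real"
  assumes fin: "finite (set_pmf P)" and I: "finite I"
    and indep: "\<And>i j. i \<in> I \<Longrightarrow> j \<in> I \<Longrightarrow> \<not> dep i j \<Longrightarrow>
      measure_pmf.expectation P (\<lambda>\<omega>. Y i \<omega> * Y j \<omega>)
        = measure_pmf.expectation P (Y i) * measure_pmf.expectation P (Y j)"
    and sym: "\<And>i j. dep i j = dep j i"
    and deg: "\<And>i. i \<in> I \<Longrightarrow> card {j\<in>I. dep i j} \<le> D"
  shows "measure_pmf.variance P (\<lambda>\<omega>. \<Sum>i\<in>I. Y i \<omega>)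
    \<le> real D * (\<Sum>i\<in>I. measure_pmf.expectation P (\<lambda>\<omega>. (Y i \<omega>)^2))"
proof -
  note [simp] = integrable_finite_pmf[OF fin]
  let ?E = "measure_pmf.expectation P"
  define C where "C i \<omega> = Y i \<omega> - ?E (Y i)" for i \<omega>
  define v where "v i = ?E (\<lambda>\<omega>. (C i \<omega>)^2)" for i
  have v_nonneg: "v i \<ge> 0" for i unfolding v_def by simp
  have CC: "?E (\<lambda>\<omega>. C i \<omega> * C j \<omega>) = ?E (\<lambda>\<omega>. Y i \<omega> * Y j \<omega>) - ?E (Y i) * ?E (Y j)" for i j
  proof -
    have "C i \<omega> * C j \<omega> = Y i \<omega> * Y j \<omega> - ?E (Y i) * Y j \<omega> - ?E (Y j) * Y i \<omega> + ?E (Y i) * ?E (Y j)" for \<omega>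
      by (simp add: C_def algebra_simps)
    then show ?thesis by simp
  qed
  have CC_le: "?E (\<lambda>\<omega>. C i \<omega> * C j \<omega>) \<le> (v i + v j) / 2" for i j
  proof -
    have "?E (\<lambda>\<omega>. C i \<omega> * C j \<omega>) \<le> ?E (\<lambda>\<omega>. ((C i \<omega>)^2 + (C j \<omega>)^2) / 2)"
      by (intro integral_mono) (use sum_squares_bound in \<open>auto simp: field_simps\<close>)
    then show ?thesis by (simp add: v_def)
  qed
  have "measure_pmf.variance P (\<lambda>\<omega>. \<Sum>i\<in>I. Y i \<omega>) = ?E (\<lambda>\<omega>. (\<Sum>i\<in>I. C i \<omega>)^2)"
    by (simp add: C_def sum_subtractf)
  also have "\<dots> = (\<Sum>i\<in>I. \<Sum>j\<in>I. ?E (\<lambda>\<omega>. C i \<omega> * C j \<omega>))"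
    by (simp add: power2_eq_square sum_product)
  also have "\<dots> \<le> (\<Sum>i\<in>I. \<Sum>j\<in>I. if dep i j then (v i + v j) / 2 else 0)"
    using CC_le indep by (intro sum_mono) (auto simp: CC[of _ _])
  also have "\<dots> = (\<Sum>i\<in>I. \<Sum>j\<in>I. if dep i j then v i / 2 else 0) + (\<Sum>i\<in>I. \<Sum>j\<in>I. if dep i j then v j / 2 else 0)"
    unfolding sum.distrib[symmetric] by (intro sum.cong refl) (auto simp: field_simps)
  also have "(\<Sum>i\<in>I. \<Sum>j\<in>I. if dep i j then v j / 2 else 0) = (\<Sum>i\<in>I. \<Sum>j\<in>I. if dep i j then v i / 2 else 0)"
    by (subst sum.swap) (simp add: sym)
  also have "(\<Sum>i\<in>I. \<Sum>j\<in>I. if dep i j then v i / 2 else 0) + (\<Sum>i\<in>I. \<Sum>j\<in>I. if dep i j then v i / 2 else 0)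
     = (\<Sum>i\<in>I. real (card {j\<in>I. dep i j}) * v i)"
    unfolding sum.distrib[symmetric] using I by (intro sum.cong refl) (simp add: sum.If_cases Int_def if_distrib[of "\<lambda>x. 2 * x"])
  also have "\<dots> \<le> (\<Sum>i\<in>I. real D * ?E (\<lambda>\<omega>. (Y i \<omega>)^2))"
  proof (intro sum_mono mult_mono)
    fix i assume "i \<in> I"
    show "real (card {j\<in>I. dep i j}) \<le> real D" using deg[OF \<open>i \<in> I\<close>] by simp
    have "v i = ?E (\<lambda>\<omega>. (Y i \<omega>)^2) - (?E (Y i))^2"
      unfolding v_def C_def by (rule measure_pmf.variance_eq) simp_all
    then show "v i \<le> ?E (\<lambda>\<omega>. (Y i \<omega>)^2)" by simp
  qed (simp_all add: v_nonneg)
  finally show ?thesis by (simp add: sum_distrib_left)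
qed

section \<open>Permutations as sets of break points\<close>

definition is_start :: "nat set \<Rightarrow> nat \<Rightarrow> bool" where
  "is_start B i \<longleftrightarrow> i = 1 \<or> i - 1 \<in> B"

definition next_break :: "nat \<Rightarrow> nat set \<Rightarrow> nat \<Rightarrow> nat" where
  "next_break n B i = Min {m \<in> insert n B. i \<le> m}"

text \<open>The permutation whose cycles are the blocks between consecutive elements of \<open>B \<union> {0, n}\<close>.  The first
element of a block goes to its last element, every other element to its predecessor.\<close>

definition perm_of :: "nat \<Rightarrow> nat set \<Rightarrow> nat \<Rightarrow> nat" where
  "perm_of n B i = (if i \<in> {1..n} then if is_start B i then next_break n B i else i - 1 else i)"

definition breaks :: "nat \<Rightarrow> (nat \<Rightarrow> nat) \<Rightarrow> nat set" where
  "breaks n \<pi> = {m \<in> {1..<n}. \<pi> (m + 1) \<noteq> m}"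

lemma next_break:
  assumes B: "B \<subseteq> {1..<n}" and i: "i \<le> n"
  shows "next_break n B i \<in> insert n B" "i \<le> next_break n B i" "next_break n B i \<le> n"
    and "\<And>m. m \<in> insert n B \<Longrightarrow> i \<le> m \<Longrightarrow> next_break n B i \<le> m"
proof -
  let ?S = "{m \<in> insert n B. i \<le> m}"
  have fin: "finite ?S" using finite_subset[OF B] by auto
  have "n \<in> ?S" using i by simp
  then have "Min ?S \<in> ?S" using fin by (intro Min_in) auto
  then show "next_break n B i \<in> insert n B" "i \<le> next_break n B i"
    by (auto simp: next_break_def)
  show le: "next_break n B i \<le> m" if "m \<in> insert n B" "i \<le> m" for m
    unfolding next_break_def using fin that by (intro Min_le) auto
  show "next_break n B i \<le> n" using le i by simp
qed

lemma next_break_eqI: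
  assumes B: "B \<subseteq> {1..<n}" and i: "i \<le> n"
    and "m \<in> insert n B" "i \<le> m" "\<And>j. i \<le> j \<Longrightarrow> j < m \<Longrightarrow> j \<notin> B"
  shows "next_break n B i = m"
proof (rule antisym)
  show "next_break n B i \<le> m" using next_break(4)[OF B i] assms by blast
  show "m \<le> next_break n B i"
    using next_break(1,2,3)[OF B i] assms by (metis insert_iff linorder_not_less order.trans subsetD atLeastLessThan_iff less_imp_le)
qed

lemma perm_of_inj:
  assumes B: "B \<subseteq> {1..<n}"
  shows "inj_on (perm_of n B) {1..n}"
proof (rule inj_onI)
  have *: False if "i \<in> {1..n}" "j \<in> {1..n}" "perm_of n B i = perm_of n B j" "i < j" for i j
  proof -
    have nj: "\<not> is_start B j \<Longrightarrow> j - 1 \<notin> insert n B" using that by (auto simp: is_start_def)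
    have ni: "\<not> is_start B i \<Longrightarrow> i - 1 \<notin> insert n B" using that by (auto simp: is_start_def)
    show False
    proof (cases "is_start B i"; cases "is_start B j")
      assume s: "is_start B i" "is_start B j"
      then have "j - 1 \<in> insert n B" using that by (auto simp: is_start_def)
      then have "next_break n B i \<le> j - 1" using next_break(4)[OF B, of i "j - 1"] that by auto
      moreover have "j \<le> next_break n B j" using next_break(2)[OF B] that by auto
      ultimately show False using that s by (auto simp: perm_of_def)
    next
      assume "is_start B i" "\<not> is_start B j"
      then show False using nj next_break(1)[OF B, of i] that by (auto simp: perm_of_def)
    next
      assume "\<not> is_start B i" "is_start B j"
      then show False using ni next_break(1)[OF B, of j] that by (auto simp: perm_of_def)
    next
      assume "\<not> is_start B i" "\<not> is_start B j"
      then show False using that by (auto simp: perm_of_def is_start_def)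
    qed
  qed
  fix i j assume "i \<in> {1..n}" "j \<in> {1..n}" "perm_of n B i = perm_of n B j"
  then show "i = j" using *[of i j] *[of j i] by (metis linorder_neqE_nat)
qed

lemma perm_of_in_S_b2:
  assumes B: "B \<subseteq> {1..<n}"
  shows "perm_of n B \<in> S_b2 n"
proof -
  have "perm_of n B ` {1..n} \<subseteq> {1..n}"
  proof safe
    fix i assume "i \<in> {1..n}"
    then show "perm_of n B i \<in> {1..n}"
      using next_break(2,3)[OF B, of i] by (auto simp: perm_of_def is_start_def)
  qed
  then have "bij_betw (perm_of n B) {1..n} {1..n}"
    using perm_of_inj[OF B] by (simp add: bij_betw_def endo_inj_surj)
  then have "perm_of n B permutes {1..n}"
    by (rule bij_imp_permutes) (auto simp: perm_of_def)
  moreover have "perm_of n B i \<ge> i - 1" if "i \<in> {2..n}" for i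
    using that next_break(2)[OF B, of i] by (auto simp: perm_of_def)
  ultimately show ?thesis by (simp add: S_b2_def)
qed

lemma breaks_perm_of:
  assumes B: "B \<subseteq> {1..<n}"
  shows "breaks n (perm_of n B) = B"
proof -
  have "perm_of n B (m + 1) \<noteq> m \<longleftrightarrow> m \<in> B" if "m \<in> {1..<n}" for m
    using that next_break(2)[OF B, of "m + 1"] by (auto simp: perm_of_def is_start_def)
  then show ?thesis using B unfolding breaks_def by blast
qed

text \<open>An element that is not mapped to its predecessor is a start.  Starts are mapped to break points (or \<open>n\<close>)
that are not smaller than themselves, and injectivity leaves only the next break: going
downwards from \<open>n\<close>, all break points beyond it are already taken by later starts.\<close>

lemma perm_of_breaks:
  assumes \<pi>: "\<pi> \<in> S_b2 n"
  shows "perm_of n (breaks n \<pi>) = \<pi>"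
proof
  let ?B = "breaks n \<pi>"
  have B: "?B \<subseteq> {1..<n}" by (auto simp: breaks_def)
  have perm: "\<pi> permutes {1..n}" and ge: "\<And>i. i \<in> {2..n} \<Longrightarrow> \<pi> i \<ge> i - 1"
    using \<pi> by (auto simp: S_b2_def)
  have inj: "\<pi> x = \<pi> y \<Longrightarrow> x = y" for x y using permutes_inj[OF perm] by (auto dest: injD)
  have mem: "\<pi> i \<in> {1..n}" if "i \<in> {1..n}" for i using permutes_in_image[OF perm] that by simp
  have nonstart: "\<pi> i = i - 1" if "i \<in> {1..n}" "\<not> is_start ?B i" for i
  proof -
    have "i - 1 \<in> {1..<n}" "i - 1 \<notin> ?B" "i - 1 + 1 = i" using that by (auto simp: is_start_def)
    then show ?thesis by (auto simp: breaks_def)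
  qed
  have start_ge: "\<pi> i \<ge> i" if "i \<in> {1..n}" "is_start ?B i" for i
  proof (cases "i = 1")
    case False
    with that have "i - 1 \<in> ?B" "i - 1 + 1 = i" by (auto simp: is_start_def)
    then have "\<pi> i \<noteq> i - 1" by (auto simp: breaks_def)
    with ge[of i] that False show ?thesis by auto
  qed (use mem that in auto)
  have start_val: "\<pi> i \<in> insert n ?B" if i: "i \<in> {1..n}" "is_start ?B i" for i
  proof (rule ccontr)
    assume no: "\<pi> i \<notin> insert n ?B"
    with mem[OF i(1)] have "\<pi> i \<in> {1..<n}" by auto
    with no have "\<pi> (\<pi> i + 1) = \<pi> i" by (auto simp: breaks_def)
    then have "\<pi> i + 1 = i" by (rule inj)
    with start_ge[OF i] show False by simp
  qed
  have start: "\<pi> i = next_break n ?B i" if "i \<in> {1..n}" "is_start ?B i" for i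
    using that
  proof (induction "n - i" arbitrary: i rule: less_induct)
    case less
    have i: "i \<le> n" using less.prems by simp
    note nb = next_break[OF B i]
    define e where "e = \<pi> i"
    have e: "e \<in> insert n ?B" "e \<ge> i" using start_val start_ge less.prems by (auto simp: e_def)
    have "e \<le> n" using e(1) B by auto
    have "next_break n ?B i \<le> e" using nb(4) e by simp
    moreover have False if lt: "next_break n ?B i < e"
    proof -
      \<comment> \<open>The last start before the value \<open>e\<close> is a later start whose value must be \<open>e\<close> as well.\<close>
      define b where "b = Max {m \<in> ?B. m < e}"
      have nbB: "next_break n ?B i \<in> {m \<in> ?B. m < e}" using nb(1) lt \<open>e \<le> n\<close> by auto
      have fin: "finite {m \<in> ?B. m < e}" using finite_subset[OF B] by auto
      have "b \<in> {m \<in> ?B. m < e}" unfolding b_def by (rule Max_in[OF fin]) (use nbB in auto)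
      then have b: "b \<in> ?B" "b < e" by auto
      have b_max: "m \<le> b" if "m \<in> ?B" "m < e" for m using fin that unfolding b_def by (intro Max_ge) auto
      have "i \<le> b" using b_max[of "next_break n ?B i"] nbB nb(2) by auto
      have s: "b + 1 \<in> {1..n}" "is_start ?B (b + 1)" using b \<open>e \<le> n\<close> by (auto simp: is_start_def)
      have "\<pi> (b + 1) = next_break n ?B (b + 1)" using less.hyps[OF _ s] \<open>i \<le> b\<close> s(1) by auto
      also have "\<dots> = e"
      proof (rule next_break_eqI[OF B])
        show "j \<notin> ?B" if "b + 1 \<le> j" "j < e" for j using b_max[of j] that by auto
      qed (use b e s in auto)
      finally have "b + 1 = i" using inj by (simp add: e_def)
      with \<open>i \<le> b\<close> show False by simp
    qed
    ultimately show ?case unfolding e_def by (metis le_neq_implies_less)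
  qed
  fix i
  show "perm_of n ?B i = \<pi> i"
    using start nonstart permutes_not_in[OF perm] by (auto simp: perm_of_def)
qed

lemma bij_betw_perm_of: "bij_betw (perm_of n) (Pow {1..<n}) (S_b2 n)"
proof (rule bij_betw_byWitness[where f' = "breaks n"])
  show "\<forall>B\<in>Pow {1..<n}. breaks n (perm_of n B) = B" using breaks_perm_of by blast
  show "\<forall>\<pi>\<in>S_b2 n. perm_of n (breaks n \<pi>) = \<pi>" using perm_of_breaks by blast
  show "perm_of n ` Pow {1..<n} \<subseteq> S_b2 n" using perm_of_in_S_b2 by blast
  show "breaks n ` S_b2 n \<subseteq> Pow {1..<n}" by (auto simp: breaks_def)
qed

abbreviation coin_pmf :: "nat set \<Rightarrow> nat set pmf" where
  "coin_pmf C \<equiv> pmf_of_set (Pow C)"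

lemma unif_b2_eq: "unif_b2 n = map_pmf (perm_of n) (coin_pmf {1..<n})"
proof -
  have "map_pmf (perm_of n) (coin_pmf {1..<n}) = pmf_of_set (perm_of n ` Pow {1..<n})"
    by (intro map_pmf_of_set_inj bij_betw_imp_inj_on[OF bij_betw_perm_of]) auto
  then show ?thesis by (simp only: unif_b2_def bij_betw_imp_surj_on[OF bij_betw_perm_of])
qed

section \<open>Cycles as blocks between break points\<close>

text \<open>The coins 0 and \<open>n\<close> do not exist, so a block at either end of \<open>{1..n}\<close> needs one break point less.\<close>

definition block_at :: "nat \<Rightarrow> nat \<Rightarrow> nat \<Rightarrow> nat set \<Rightarrow> bool" where
  "block_at n k i B \<longleftrightarrow> {i - 1, i + k - 1} \<inter> {1..<n} \<subseteq> B \<and> {i..<i + k - 1} \<inter> B = {}"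

lemma occurs_perm_of:
  assumes B: "B \<subseteq> {1..<n}" and i: "1 \<le> i" and k: "1 \<le> k" and ik: "i + k - 1 \<le> n"
  shows "occurs_I k i (perm_of n B) \<longleftrightarrow> block_at n k i B"
proof
  have i_mem: "i \<in> {1..n}" using i ik k by auto
  have i_n: "i \<le> n" using i_mem by simp
  assume occ: "occurs_I k i (perm_of n B)"
  then have val: "perm_of n B i = i + k - 1" using k by (auto simp: occurs_I_def cycle_I_def)
  have start: "is_start B i"
  proof (rule ccontr)
    assume "\<not> is_start B i"
    then show False using val i_mem k by (auto simp: perm_of_def is_start_def)
  qed
  then have nb: "next_break n B i = i + k - 1" using val i_mem by (simp add: perm_of_def)
  show "block_at n k i B"
    unfolding block_at_def
  proof (intro conjI)
    show "{i - 1, i + k - 1} \<inter> {1..<n} \<subseteq> B"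
      using start next_break(1)[OF B i_n] i unfolding nb by (auto simp: is_start_def)
    show "{i..<i + k - 1} \<inter> B = {}"
      using next_break(4)[OF B i_n] unfolding nb by fastforce
  qed
next
  have i_mem: "i \<in> {1..n}" using i ik k by auto
  have i_n: "i \<le> n" using i_mem by simp
  assume blk: "block_at n k i B"
  have "is_start B i"
  proof (cases "i = 1")
    case False
    with i i_n have "i - 1 \<in> {i - 1, i + k - 1} \<inter> {1..<n}" by auto
    with blk show ?thesis by (auto simp: block_at_def is_start_def)
  qed (simp add: is_start_def)
  moreover have "next_break n B i = i + k - 1"
    using blk i ik k by (intro next_break_eqI[OF B i_n]) (auto simp: block_at_def)
  ultimately have "perm_of n B i = i + k - 1" using i_mem by (simp add: perm_of_def)
  moreover have "perm_of n B j = j - 1" if "i < j" "j \<le> i + k - 1" for j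
  proof -
    have "j - 1 \<in> {i..<i + k - 1}" using that by auto
    then have "\<not> is_start B j" using blk that i by (auto simp: block_at_def is_start_def)
    then show ?thesis using that ik i by (auto simp: perm_of_def)
  qed
  ultimately show "occurs_I k i (perm_of n B)"
    using k by (auto simp: occurs_I_def cycle_I_def)
qed

lemma orbit_of_occurs:
  assumes occ: "occurs_I k i \<pi>" and k: "1 \<le> k" and j: "j \<in> {i..i + k - 1}"
  shows "orbit \<pi> j = {i..i + k - 1}"
proof
  have \<pi>i: "\<pi> i = i + k - 1" using occ k by (auto simp: occurs_I_def cycle_I_def)
  have \<pi>j: "\<pi> m = m - 1" if "i < m" "m \<le> i + k - 1" for m
    using occ that by (auto simp: occurs_I_def cycle_I_def)
  have closed: "\<pi> m \<in> {i..i + k - 1}" if "m \<in> {i..i + k - 1}" for m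
    using \<pi>i \<pi>j[of m] that k by (cases "m = i") auto
  show "orbit \<pi> j \<subseteq> {i..i + k - 1}"
  proof
    fix x assume "x \<in> orbit \<pi> j"
    then show "x \<in> {i..i + k - 1}"
    proof induction
      case base then show ?case using closed[OF j] .
    next
      case (step y) then show ?case using closed by blast
    qed
  qed
  have down: "i \<in> orbit \<pi> j \<or> j = i"
  proof -
    have "d < j - i \<Longrightarrow> j - 1 - d \<in> orbit \<pi> j" for d
    proof (induction d)
      case 0
      then show ?case using \<pi>j[of j] j orbit.base[of \<pi> j] by auto
    next
      case (Suc d)
      then have "j - 1 - d \<in> orbit \<pi> j" by simp
      moreover have "\<pi> (j - 1 - d) = j - 1 - Suc d" using \<pi>j[of "j - 1 - d"] Suc.prems j by auto
      ultimately show ?case using orbit.step[of "j - 1 - d" \<pi> j] by simp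
    qed
    from this[of "j - i - 1"] show ?thesis using j by (cases "j = i") auto
  qed
  then have top: "i + k - 1 \<in> orbit \<pi> j"
    using orbit.step[of i \<pi> j] orbit.base[of \<pi> j] \<pi>i by auto
  have "d < k \<Longrightarrow> i + k - 1 - d \<in> orbit \<pi> j" for d
  proof (induction d)
    case 0 then show ?case using top by simp
  next
    case (Suc d)
    then have "i + k - 1 - d \<in> orbit \<pi> j" by simp
    moreover have "\<pi> (i + k - 1 - d) = i + k - 1 - Suc d" using \<pi>j[of "i + k - 1 - d"] Suc.prems by auto
    ultimately show ?case using orbit.step[of "i + k - 1 - d" \<pi> j] by simp
  qed
  note reach = this
  show "{i..i + k - 1} \<subseteq> orbit \<pi> j"
  proof
    fix x assume "x \<in> {i..i + k - 1}"
    then show "x \<in> orbit \<pi> j" using reach[of "i + k - 1 - x"] k by auto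
  qed
qed

text \<open>Unless \<open>j\<close> starts a block, it belongs to the same block as \<open>j - 1\<close>.\<close>

lemma element_in_block:
  assumes B: "B \<subseteq> {1..<n}" and j: "j \<in> {1..n}"
  shows "\<exists>i l. 1 \<le> i \<and> 1 \<le> l \<and> i + l - 1 \<le> n \<and> j \<in> {i..i + l - 1} \<and> block_at n l i B"
  using j
proof (induction j)
  case (Suc j)
  show ?case
  proof (cases "is_start B (Suc j)")
    case True
    have le: "Suc j \<le> n" using Suc.prems by simp
    note nb = next_break[OF B le]
    have "block_at n (next_break n B (Suc j) - j) (Suc j) B"
      using True nb B by (force simp: block_at_def is_start_def)
    then show ?thesis using nb(2,3)
      by (intro exI[of _ "Suc j"] exI[of _ "next_break n B (Suc j) - j"]) auto
  next
    case False
    then have j: "j \<ge> 1" "j \<notin> B" by (auto simp: is_start_def)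
    with Suc obtain i l where il: "1 \<le> i" "1 \<le> l" "i + l - 1 \<le> n" "j \<in> {i..i + l - 1}" "block_at n l i B" by auto
    have "j \<noteq> i + l - 1" using il(5) j Suc.prems by (auto simp: block_at_def)
    with il have "Suc j \<in> {i..i + l - 1}" by auto
    with il show ?thesis by blast
  qed
qed simp

text \<open>Every orbit is an interval \<open>{i..i + l - 1}\<close> carrying a block of length \<open>l\<close>, and the interval
determines \<open>i\<close> and \<open>l\<close>.\<close>

lemma num_cycles_perm_of:
  assumes B: "B \<subseteq> {1..<n}" and k: "1 \<le> k" "k \<le> n"
  shows "num_cycles n k (perm_of n B) = (\<Sum>i=1..n - k + 1. of_bool (block_at n k i B))"
proof -
  let ?\<pi> = "perm_of n B" and ?I = "{i \<in> {1..n - k + 1}. block_at n k i B}"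
  have "{c \<in> orbit ?\<pi> ` {1..n}. card c = k} = (\<lambda>i. {i..i + k - 1}) ` ?I"
  proof (intro set_eqI iffI)
    fix c assume "c \<in> {c \<in> orbit ?\<pi> ` {1..n}. card c = k}"
    then obtain j where j: "j \<in> {1..n}" "c = orbit ?\<pi> j" "card c = k" by auto
    from element_in_block[OF B j(1)] obtain i l where il: "1 \<le> i" "1 \<le> l" "i + l - 1 \<le> n" "j \<in> {i..i + l - 1}"
      "block_at n l i B" by auto
    then have "c = {i..i + l - 1}"
      using orbit_of_occurs[of l i ?\<pi> j] occurs_perm_of[OF B] j(2) by auto
    moreover from this j(3) il have "l = k" by auto
    ultimately show "c \<in> (\<lambda>i. {i..i + k - 1}) ` ?I" using il k by auto
  next
    fix c assume "c \<in> (\<lambda>i. {i..i + k - 1}) ` ?I"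
    then obtain i where i: "i \<in> {1..n - k + 1}" "block_at n k i B" "c = {i..i + k - 1}" by auto
    then have "orbit ?\<pi> i = c"
      using orbit_of_occurs[of k i ?\<pi> i] occurs_perm_of[OF B, of i k] k by auto
    moreover have "i \<in> {1..n}" using i k by auto
    moreover have "card c = k" using i k by auto
    ultimately show "c \<in> {c \<in> orbit ?\<pi> ` {1..n}. card c = k}" by auto
  qed
  moreover have "inj_on (\<lambda>i. {i..i + k - 1}) ?I"
  proof (rule inj_onI)
    fix x y assume "{x..x + k - 1} = {y..y + k - 1}"
    moreover have "x \<le> x + k - 1" "y \<le> y + k - 1" using k by auto
    ultimately show "x = y" using Icc_eq_Icc[of x "x + k - 1" y "y + k - 1"] by auto
  qed
  ultimately have "num_cycles n k ?\<pi> = card ?I" by (simp add: num_cycles_def card_image)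
  then show ?thesis by (simp add: Int_def del: sum.cl_ivl_Suc)
qed

section \<open>Independent fair coins\<close>

abbreviation coin_E :: "nat set \<Rightarrow> (nat set \<Rightarrow> real) \<Rightarrow> real" where
  "coin_E C f \<equiv> measure_pmf.expectation (coin_pmf C) f"

definition depends_on :: "nat set \<Rightarrow> (nat set \<Rightarrow> 'a) \<Rightarrow> bool" where
  "depends_on A f \<longleftrightarrow> (\<forall>B. f B = f (B \<inter> A))"

lemma finite_coin_pmf: "finite C \<Longrightarrow> finite (set_pmf (coin_pmf C))"
  by (subst set_pmf_of_set) auto

lemma coin_E_eq_average:
  assumes "finite C"
  shows "coin_E C f = (\<Sum>B\<in>Pow C. f B) / 2 ^ card C"
  using assms by (subst integral_pmf_of_set) (auto simp: card_Pow)

lemma coin_E_cong: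
  assumes "finite C" "\<And>B. B \<subseteq> C \<Longrightarrow> f B = g B"
  shows "coin_E C f = coin_E C g"
  using assms by (simp add: coin_E_eq_average)

lemma coin_E_split:
  assumes C: "finite C" and A: "A \<subseteq> C"
  shows "coin_E C (\<lambda>B. u (B \<inter> A) * v (B - A)) = coin_E A u * coin_E (C - A) v"
proof -
  have fA: "finite A" using A C by (rule finite_subset)
  have "(\<Sum>B\<in>Pow C. u (B \<inter> A) * v (B - A)) = (\<Sum>(D, D')\<in>Pow A \<times> Pow (C - A). u D * v D')"
  proof (rule sum.reindex_bij_witness)
    show "(\<lambda>(D, D'). D \<union> D') (B \<inter> A, B - A) = B" for B :: "nat set" by auto
    show "(\<lambda>B. (B \<inter> A, B - A)) ((\<lambda>(D, D'). D \<union> D') x) = x" if "x \<in> Pow A \<times> Pow (C - A)" for x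
      using that by auto
  qed (use A in auto)
  also have "\<dots> = (\<Sum>D\<in>Pow A. u D) * (\<Sum>D'\<in>Pow (C - A). v D')"
    by (simp add: sum_product sum.cartesian_product)
  finally have "(\<Sum>B\<in>Pow C. u (B \<inter> A) * v (B - A)) = \<dots>" .
  moreover have "(2::real) ^ card C = 2 ^ card A * 2 ^ card (C - A)"
    using C A fA by (simp add: power_add[symmetric] card_Diff_subset card_mono)
  ultimately show ?thesis using C fA by (simp add: coin_E_eq_average)
qed

lemma depends_onD:
  assumes "depends_on A f" "B \<inter> A = B' \<inter> A"
  shows "f B = f B'"
  using assms unfolding depends_on_def by metis

lemma depends_onI:
  assumes "\<And>B B'. B \<inter> A = B' \<inter> A \<Longrightarrow> f B = f B'"
  shows "depends_on A f"
  unfolding depends_on_def by (intro allI assms) auto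

lemma depends_on_mono: "depends_on A f \<Longrightarrow> A \<subseteq> A' \<Longrightarrow> depends_on A' f"
  by (rule depends_onI, erule depends_onD) blast

text \<open>Splitting the coins into those in \<open>A\<close> and the others turns the average over all subsets of \<open>C\<close> into a
product of two averages.\<close>

lemma coin_E_indep:
  assumes C: "finite C" and f: "depends_on A f" and g: "depends_on A' g" and disj: "A \<inter> A' = {}"
  shows "coin_E C (\<lambda>B. f B * g B) = coin_E C f * coin_E C g"
proof -
  note eq = coin_E_cong[OF C]
  have f': "f (B \<inter> (A \<inter> C)) = f B" if "B \<subseteq> C" for B using that by (intro depends_onD[OF f]) auto
  have g': "g (B - A \<inter> C) = g B" if "B \<subseteq> C" for B using that disj by (intro depends_onD[OF g]) auto
  have "coin_E C (\<lambda>B. f B * g B) = coin_E C (\<lambda>B. f (B \<inter> (A \<inter> C)) * g (B - A \<inter> C))"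
    using f' g' by (intro eq) auto
  also have "\<dots> = coin_E (A \<inter> C) f * coin_E (C - A \<inter> C) g" by (rule coin_E_split) (use C in auto)
  also have "coin_E (A \<inter> C) f = coin_E C f"
  proof -
    have "coin_E C f = coin_E C (\<lambda>B. f (B \<inter> (A \<inter> C)) * 1)" using f' by (intro eq) auto
    also have "\<dots> = coin_E (A \<inter> C) f * coin_E (C - A \<inter> C) (\<lambda>_. 1)" by (rule coin_E_split) (use C in auto)
    finally show ?thesis by simp
  qed
  also have "coin_E (C - A \<inter> C) g = coin_E C g"
  proof -
    have "coin_E C g = coin_E C (\<lambda>B. 1 * g (B - A \<inter> C))" using g' by (intro eq) auto
    also have "\<dots> = coin_E (A \<inter> C) (\<lambda>_. 1) * coin_E (C - A \<inter> C) g" by (rule coin_E_split) (use C in auto)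
    finally show ?thesis by simp
  qed
  finally show ?thesis .
qed

text \<open>The coins in \<open>T \<union> U\<close> are prescribed and the others are free.\<close>

lemma coin_prob:
  assumes C: "finite C" and T: "T \<subseteq> C" and U: "U \<subseteq> C" and disj: "T \<inter> U = {}"
  shows "coin_E C (\<lambda>B. of_bool (T \<subseteq> B \<and> U \<inter> B = {})) = 1 / 2 ^ card (T \<union> U)"
proof -
  let ?D = "C - (T \<union> U)"
  have "{B \<in> Pow C. T \<subseteq> B \<and> U \<inter> B = {}} = (\<lambda>D. D \<union> T) ` Pow ?D"
  proof (intro set_eqI iffI)
    fix B assume "B \<in> {B \<in> Pow C. T \<subseteq> B \<and> U \<inter> B = {}}"
    then have "B = (B - T) \<union> T" "B - T \<in> Pow ?D" by auto
    then show "B \<in> (\<lambda>D. D \<union> T) ` Pow ?D" by (rule image_eqI)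
  qed (use T U disj in auto)
  moreover have "inj_on (\<lambda>D. D \<union> T) (Pow ?D)" by (rule inj_onI) blast
  ultimately have "card {B \<in> Pow C. T \<subseteq> B \<and> U \<inter> B = {}} = 2 ^ card ?D"
    using C by (simp add: card_image card_Pow)
  then have "coin_E C (\<lambda>B. of_bool (T \<subseteq> B \<and> U \<inter> B = {})) = 2 ^ card ?D / 2 ^ card C"
    using C by (simp add: coin_E_eq_average Int_def)
  also have "card C = card ?D + card (T \<union> U)"
    using C T U card_Diff_subset[of "T \<union> U" C] card_mono[of C "T \<union> U"] finite_subset[of "T \<union> U" C] by simp
  finally show ?thesis by (simp add: power_add)
qed

section \<open>Blocks of a fixed length\<close>

locale block_model =
  fixes n k :: nat
  assumes k: "1 \<le> k" and kn: "k < n"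
begin

definition coins :: "nat set" where "coins = {1..<n}"

definition J :: "nat set" where "J = {1..n - k + 1}"

abbreviation E :: "(nat set \<Rightarrow> real) \<Rightarrow> real" where "E \<equiv> coin_E coins"

definition ind :: "nat \<Rightarrow> nat set \<Rightarrow> real" where
  "ind i B = of_bool (block_at n k i B)"

definition p :: "nat \<Rightarrow> real" where
  "p i = (if i \<in> {1, n - k + 1} then 1 / 2 ^ k else 1 / 2 ^ (k + 1))"

definition X :: "nat \<Rightarrow> nat set \<Rightarrow> real" where "X i B = ind i B - p i"

text \<open>The coins on which the block at \<open>i\<close> depends; for the first block it also contains the nonexistent coin 0,
and for the last one the nonexistent coin \<open>n\<close>.\<close>

definition win :: "nat \<Rightarrow> nat set" where "win i = {i - 1..i + k - 1}"

lemma finite_coins_J [simp]: "finite coins" "finite J" by (simp_all add: coins_def J_def)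

lemma integrable_coins [simp]: "integrable (measure_pmf (coin_pmf coins)) (f :: nat set \<Rightarrow> real)"
  by (intro integrable_finite_pmf finite_coin_pmf) simp

lemma ind_01: "ind i B = 0 \<or> ind i B = 1" "0 \<le> ind i B" "ind i B \<le> 1" "ind i B ^ 2 = ind i B"
  by (auto simp: ind_def)

lemma depends_ind: "depends_on (win i) (ind i)"
proof (rule depends_onI)
  fix B B' assume "B \<inter> win i = B' \<inter> win i"
  then have mem: "x \<in> B \<longleftrightarrow> x \<in> B'" if "x \<in> win i" for x using that by blast
  have "{i - 1, i + k - 1} \<subseteq> win i" "{i..<i + k - 1} \<subseteq> win i" using k by (auto simp: win_def)
  with mem show "ind i B = ind i B'" unfolding ind_def block_at_def by (intro arg_cong[of _ _ of_bool]) blast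
qed

definition req :: "nat \<Rightarrow> nat set" where
  "req i = {i - 1, i + k - 1} \<inter> coins"

definition forb :: "nat \<Rightarrow> nat set" where
  "forb i = {i..<i + k - 1}"

lemma ind_eq: "ind i B = of_bool (req i \<subseteq> B \<and> forb i \<inter> B = {})"
  by (simp add: ind_def block_at_def req_def forb_def coins_def)

lemma req_forb:
  assumes "i \<in> J"
  shows "req i \<subseteq> coins" "forb i \<subseteq> coins" "req i \<inter> forb i = {}" "req i \<union> forb i = win i \<inter> coins"
  using assms k kn by (auto simp: req_def forb_def win_def coins_def J_def)

lemma p_eq_card:
  assumes i: "i \<in> J"
  shows "p i = 1 / 2 ^ card (win i \<inter> coins)"
proof -
  consider "i = 1" | "i = n - k + 1" "i \<noteq> 1" | "i \<notin> {1, n - k + 1}" by blast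
  then show ?thesis
  proof cases
    case 1
    then have "win i \<inter> coins = {1..k}" using k kn by (auto simp: win_def coins_def J_def)
    then show ?thesis using 1 by (simp add: p_def)
  next
    case 2
    then have "win i \<inter> coins = {n - k..<n}" using k kn by (auto simp: win_def coins_def J_def)
    then show ?thesis using 2 k kn by (simp add: p_def)
  next
    case 3
    then have "win i \<inter> coins = {i - 1..i + k - 1}" using i k kn by (auto simp: win_def coins_def J_def)
    then show ?thesis using 3 i by (auto simp: p_def J_def)
  qed
qed

lemma E_ind: "i \<in> J \<Longrightarrow> E (ind i) = p i"
  unfolding ind_eq[abs_def] by (subst coin_prob) (auto simp: req_forb p_eq_card)

lemma E_X: "i \<in> J \<Longrightarrow> E (X i) = 0"
  using E_ind[of i] by (simp add: X_def[abs_def])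

text \<open>The break in front of the later block lies inside the earlier one.\<close>

lemma ind_exclusive:
  assumes "i \<in> J" "j \<in> J" "i < j" "j < i + k"
  shows "ind i B * ind j B = 0"
proof -
  have "j - 1 \<in> req j" "j - 1 \<in> forb i" using assms k kn by (auto simp: req_def forb_def coins_def J_def)
  then show ?thesis by (auto simp: ind_eq)
qed

text \<open>The windows of two touching blocks share exactly the coin \<open>i + k - 1\<close>, and both blocks need a break there.
This holds for the end blocks as well, whose probabilities are larger.\<close>

lemma E_ind_adjacent:
  assumes i: "i \<in> J" and j: "i + k \<in> J"
  shows "E (\<lambda>B. ind i B * ind (i + k) B) = 2 * p i * p (i + k)"
proof -
  let ?j = "i + k"
  have "ind i B * ind ?j B = of_bool (req i \<union> req ?j \<subseteq> B \<and> (forb i \<union> forb ?j) \<inter> B = {})" for B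
    by (auto simp: ind_eq)
  moreover have "(req i \<union> req ?j) \<inter> (forb i \<union> forb ?j) = {}"
    using i j k kn by (auto simp: req_def forb_def coins_def J_def)
  ultimately have "E (\<lambda>B. ind i B * ind ?j B) = 1 / 2 ^ card (req i \<union> req ?j \<union> (forb i \<union> forb ?j))"
    using req_forb[OF i] req_forb[OF j] by (simp only: coin_prob finite_coins_J Un_least)
  also have "req i \<union> req ?j \<union> (forb i \<union> forb ?j) = (win i \<inter> coins) \<union> (win ?j \<inter> coins)"
    using req_forb(4)[OF i] req_forb(4)[OF j] by blast
  finally have E: "E (\<lambda>B. ind i B * ind ?j B) = 1 / 2 ^ card ((win i \<inter> coins) \<union> (win ?j \<inter> coins))" .
  have "(win i \<inter> coins) \<inter> (win ?j \<inter> coins) = {i + k - 1}"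
    using i j k kn by (auto simp: win_def coins_def J_def)
  then have "card (win i \<inter> coins) + card (win ?j \<inter> coins) = card ((win i \<inter> coins) \<union> (win ?j \<inter> coins)) + 1"
    using card_Un_Int[of "win i \<inter> coins" "win ?j \<inter> coins"] by simp
  then have "(2::real) ^ card (win i \<inter> coins) * 2 ^ card (win ?j \<inter> coins)
      = 2 * 2 ^ card ((win i \<inter> coins) \<union> (win ?j \<inter> coins))"
    unfolding power_add[symmetric] by simp
  then show ?thesis unfolding E p_eq_card[OF i] p_eq_card[OF j] by (simp add: field_simps)
qed

text \<open>The positions whose blocks are dependent on the block at \<open>i\<close> fall into those that overlap it and those
that touch it (\<open>adj\<close>).\<close>

definition overl :: "nat \<Rightarrow> nat set" where
  "overl i = {j \<in> J. j \<noteq> i \<and> i < j + k \<and> j < i + k}"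

definition adj :: "nat \<Rightarrow> nat set" where
  "adj i = {j \<in> J. j = i + k \<or> i = j + k}"

definition near :: "nat \<Rightarrow> nat set" where
  "near i = {j \<in> J. i \<le> j + k \<and> j \<le> i + k}"

lemma finite_near [simp]: "finite (overl i)" "finite (adj i)" "finite (near i)"
  by (auto simp: overl_def adj_def near_def)

lemma near_subset_J: "overl i \<subseteq> J" "adj i \<subseteq> J" "near i \<subseteq> J"
  by (auto simp: overl_def adj_def near_def)

lemma sum_near:
  assumes "i \<in> J"
  shows "sum f (near i) = f i + sum f (overl i) + (sum f (adj i) :: real)"
proof -
  have "near i = insert i (overl i) \<union> adj i" using assms k by (auto simp: near_def overl_def adj_def)
  moreover have "insert i (overl i) \<inter> adj i = {}" "i \<notin> overl i" using k by (auto simp: overl_def adj_def)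
  ultimately show ?thesis by (simp add: sum.union_disjoint)
qed

lemma E_ind_product:
  assumes i: "i \<in> J" and j: "j \<in> J"
  shows "j \<in> overl i \<Longrightarrow> E (\<lambda>B. ind i B * ind j B) = 0"
    and "j \<in> adj i \<Longrightarrow> E (\<lambda>B. ind i B * ind j B) = 2 * p i * p j"
    and "j \<notin> near i \<Longrightarrow> E (\<lambda>B. ind i B * ind j B) = p i * p j"
proof -
  show "E (\<lambda>B. ind i B * ind j B) = 0" if "j \<in> overl i"
  proof -
    have "ind i B * ind j B = 0" for B
      using ind_exclusive[OF i j, of B] ind_exclusive[OF j i, of B] that
      by (cases "i < j") (auto simp: overl_def)
    then show ?thesis by (simp only: integral_zero)
  qed
  show "E (\<lambda>B. ind i B * ind j B) = 2 * p i * p j" if "j \<in> adj i"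
    using that E_ind_adjacent[of i] E_ind_adjacent[of j] i j by (auto simp: adj_def mult.commute mult.left_commute)
  show "E (\<lambda>B. ind i B * ind j B) = p i * p j" if "j \<notin> near i"
  proof -
    have "win i \<inter> win j = {}" using that i j by (auto simp: near_def win_def J_def)
    then show ?thesis
      using coin_E_indep[OF _ depends_ind[of i] depends_ind[of j]] i j by (simp add: E_ind)
  qed
qed

text \<open>The subtracted constant 1 makes \<open>T i\<close> small both when block \<open>i\<close> occurs, since it cancels the
contribution of block \<open>i\<close>, and when it does not.\<close>

definition T :: "nat \<Rightarrow> nat set \<Rightarrow> real" where
  "T i B = (\<Sum>j\<in>near i. ind j B) - 1"

definition adj_sum :: "nat \<Rightarrow> nat set \<Rightarrow> real" where
  "adj_sum i B = (\<Sum>j\<in>adj i. ind j B)"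

lemma sum_exclusive_le_1:
  assumes S: "S \<subseteq> J" and close: "\<And>i j. i \<in> S \<Longrightarrow> j \<in> S \<Longrightarrow> j < i + k"
  shows "(\<Sum>j\<in>S. ind j B) \<le> 1"
proof (cases "\<exists>i\<in>S. ind i B = 1")
  case True
  then obtain i where i: "i \<in> S" "ind i B = 1" by blast
  have "ind j B = 0" if "j \<in> S" "j \<noteq> i" for j
    using ind_exclusive[of i j B] ind_exclusive[of j i B] i that S close
    by (cases "i < j") (auto simp: subset_iff)
  then have "(\<Sum>j\<in>S. ind j B) = (\<Sum>j\<in>S. if j = i then 1 else 0)"
    using i by (intro sum.cong) auto
  also have "\<dots> = 1" using i finite_subset[OF S] by simp
  finally show ?thesis by simp
next
  case False
  then have "ind j B = 0" if "j \<in> S" for j using ind_01(1) that by blast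
  then show ?thesis by simp
qed

lemma T_of_ind_1:
  assumes i: "i \<in> J" and "ind i B = 1"
  shows "T i B = adj_sum i B"
proof -
  have "ind j B = 0" if "j \<in> overl i" for j
    using ind_exclusive[of i j B] ind_exclusive[of j i B] that assms
    by (cases "i < j") (auto simp: overl_def)
  then show ?thesis using assms by (simp add: T_def adj_sum_def sum_near)
qed

text \<open>The blocks near \<open>i\<close> on one side of \<open>i\<close> overlap each other, so at most one of them occurs.\<close>

lemma T_of_ind_0:
  assumes i: "i \<in> J" and "ind i B = 0"
  shows "\<bar>T i B\<bar> \<le> 1"
proof -
  let ?L = "{j \<in> near i. j < i}" and ?R = "{j \<in> near i. j > i}"
  have "(\<Sum>j\<in>?L. ind j B) \<le> 1" "(\<Sum>j\<in>?R. ind j B) \<le> 1"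
    by (rule sum_exclusive_le_1, auto simp: near_def)+
  moreover have "(\<Sum>j\<in>near i. ind j B) = ind i B + ((\<Sum>j\<in>?L. ind j B) + (\<Sum>j\<in>?R. ind j B))"
  proof -
    have "near i = insert i (?L \<union> ?R)" using i by (auto simp: near_def)
    moreover have "finite ?L" "finite ?R" by simp_all
    moreover have "i \<notin> ?L \<union> ?R" "?L \<inter> ?R = {}" by auto
    ultimately show ?thesis by (metis (no_types, lifting) finite_Un sum.insert sum.union_disjoint)
  qed
  moreover have "(\<Sum>j\<in>near i. ind j B) \<ge> 0" by (intro sum_nonneg ind_01)
  ultimately show ?thesis using assms by (simp add: T_def abs_le_iff)
qed

section \<open>The variance of the number of blocks\<close>

lemma p_bounds: "0 < p i" "p i \<le> 1 / 2" "i \<notin> {1, n - k + 1} \<Longrightarrow> p i \<le> 1 / 4"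
proof -
  have "(2::real) ^ 1 \<le> 2 ^ k" using k by (intro power_increasing) auto
  then show "0 < p i" "p i \<le> 1 / 2" "i \<notin> {1, n - k + 1} \<Longrightarrow> p i \<le> 1 / 4"
    by (auto simp: p_def field_simps)
qed

definition nbr_p :: "nat \<Rightarrow> real" where "nbr_p i = (\<Sum>j\<in>adj i. p j)"

definition sig2 :: real where
  "sig2 = (\<Sum>i\<in>J. p i * (1 - p i - (\<Sum>j\<in>overl i. p j) + nbr_p i))"

lemma E_X_ind:
  assumes "i \<in> J" "j \<in> J"
  shows "E (\<lambda>B. X i B * ind j B) = E (\<lambda>B. ind i B * ind j B) - p i * p j"
  using E_ind[OF assms(2)] by (simp add: X_def left_diff_distrib)

text \<open>The covariance with block \<open>i\<close> is \<open>p i - (p i)\<^sup>2\<close> for block \<open>i\<close> itself, \<open>- p i * p j\<close> for an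
overlapping block \<open>j\<close> and \<open>p i * p j\<close> for a touching one.\<close>

lemma E_X_T:
  assumes i: "i \<in> J"
  shows "E (\<lambda>B. X i B * T i B) = p i * (1 - p i - (\<Sum>j\<in>overl i. p j) + nbr_p i)"
proof -
  have "E (\<lambda>B. X i B * T i B) = E (\<lambda>B. (\<Sum>j\<in>near i. X i B * ind j B) - X i B)"
    by (simp add: T_def right_diff_distrib sum_distrib_left)
  also have "\<dots> = (\<Sum>j\<in>near i. E (\<lambda>B. X i B * ind j B))" using E_X[OF i] by simp
  also have "\<dots> = E (\<lambda>B. X i B * ind i B) + (\<Sum>j\<in>overl i. E (\<lambda>B. X i B * ind j B))
      + (\<Sum>j\<in>adj i. E (\<lambda>B. X i B * ind j B))" by (rule sum_near[OF i])
  also have "E (\<lambda>B. X i B * ind i B) = p i - p i * p i"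
    unfolding E_X_ind[OF i i] using E_ind[OF i] by (simp add: ind_01(4)[unfolded power2_eq_square])
  also have "(\<Sum>j\<in>overl i. E (\<lambda>B. X i B * ind j B)) = (\<Sum>j\<in>overl i. - (p i * p j))"
  proof (rule sum.cong)
    fix j assume "j \<in> overl i"
    then have j: "j \<in> J" "j \<in> overl i" using near_subset_J by auto
    show "E (\<lambda>B. X i B * ind j B) = - (p i * p j)" unfolding E_X_ind[OF i j(1)] E_ind_product(1)[OF i j] by simp
  qed simp
  also have "(\<Sum>j\<in>adj i. E (\<lambda>B. X i B * ind j B)) = (\<Sum>j\<in>adj i. p i * p j)"
  proof (rule sum.cong)
    fix j assume "j \<in> adj i"
    then have j: "j \<in> J" "j \<in> adj i" using near_subset_J by auto
    show "E (\<lambda>B. X i B * ind j B) = p i * p j" unfolding E_X_ind[OF i j(1)] E_ind_product(2)[OF i j] by simp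
  qed simp
  finally show ?thesis
    by (simp add: nbr_p_def sum_distrib_left[symmetric] sum_negf right_diff_distrib distrib_left)
qed

lemma sum_E_X_ind:
  assumes i: "i \<in> J"
  shows "(\<Sum>j\<in>J. E (\<lambda>B. X i B * ind j B)) = E (\<lambda>B. X i B * T i B)"
proof -
  have "(\<Sum>j\<in>J. E (\<lambda>B. X i B * ind j B)) = (\<Sum>j\<in>near i. E (\<lambda>B. X i B * ind j B))"
  proof (rule sum.mono_neutral_right)
    show "\<forall>j\<in>J - near i. E (\<lambda>B. X i B * ind j B) = 0"
      using E_X_ind[OF i] E_ind_product(3)[OF i] by simp
  qed (use near_subset_J in auto)
  also have "\<dots> = E (\<lambda>B. (\<Sum>j\<in>near i. X i B * ind j B) - X i B)" using E_X[OF i] by simp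
  also have "\<dots> = E (\<lambda>B. X i B * T i B)"
    by (simp add: T_def right_diff_distrib sum_distrib_left)
  finally show ?thesis .
qed

lemma E_sum_X_T: "E (\<lambda>B. \<Sum>i\<in>J. X i B * T i B) = sig2"
  by (simp add: sig2_def E_X_T)

lemma variance_count: "measure_pmf.variance (coin_pmf coins) (\<lambda>B. \<Sum>i\<in>J. ind i B) = sig2"
proof -
  have "measure_pmf.variance (coin_pmf coins) (\<lambda>B. \<Sum>i\<in>J. ind i B) = E (\<lambda>B. (\<Sum>i\<in>J. X i B)^2)"
    by (simp add: X_def sum_subtractf E_ind)
  also have "\<dots> = (\<Sum>i\<in>J. \<Sum>j\<in>J. E (\<lambda>B. X i B * X j B))"
    by (simp add: power2_eq_square sum_product)
  also have "\<dots> = (\<Sum>i\<in>J. \<Sum>j\<in>J. E (\<lambda>B. X i B * ind j B))"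
  proof (intro sum.cong refl)
    fix i j assume "i \<in> J" "j \<in> J"
    have "E (\<lambda>B. X i B * X j B) = E (\<lambda>B. X i B * ind j B - X i B * p j)"
      by (simp add: X_def[of j] right_diff_distrib)
    then show "E (\<lambda>B. X i B * X j B) = E (\<lambda>B. X i B * ind j B)" using E_X[OF \<open>i \<in> J\<close>] by simp
  qed
  also have "\<dots> = sig2" by (simp add: sum_E_X_ind sig2_def E_X_T)
  finally show ?thesis .
qed

lemma card_adj: "card (adj i) \<le> 2" "i \<in> {1, n - k + 1} \<Longrightarrow> card (adj i) \<le> 1"
proof -
  have "adj i \<subseteq> {i + k, i - k}" by (auto simp: adj_def)
  from card_mono[OF _ this] show "card (adj i) \<le> 2" by (simp add: card_insert_if split: if_splits)
  assume "i \<in> {1, n - k + 1}"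
  then have "adj i \<subseteq> {if i = 1 then i + k else i - k}" using k by (auto simp: adj_def J_def)
  from card_mono[OF _ this] show "card (adj i) \<le> 1" by simp
qed

lemma nbr_p_bounds: "0 \<le> nbr_p i" "nbr_p i \<le> real (card (adj i)) / 2 ^ k" "nbr_p i \<le> 1"
proof -
  show "0 \<le> nbr_p i" unfolding nbr_p_def by (intro sum_nonneg less_imp_le p_bounds)
  have "p j \<le> 1 / 2 ^ k" for j by (auto simp: p_def field_simps)
  from sum_bounded_above[of "adj i" p, OF this] show "nbr_p i \<le> real (card (adj i)) / 2 ^ k"
    by (simp add: nbr_p_def)
  from sum_bounded_above[of "adj i" p, OF p_bounds(2)] show "nbr_p i \<le> 1"
    using card_adj(1)[of i] by (simp add: nbr_p_def)
qed

text \<open>The window contains at most \<open>2 * k - 1\<close> positions, and at most two of them are ends, which have twice the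
usual probability.\<close>

lemma window_mass:
  assumes i: "i \<in> J"
  shows "p i + (\<Sum>j\<in>overl i. p j) \<le> 3 / 4"
proof -
  let ?V = "insert i (overl i)"
  have "?V \<subseteq> {i + 1 - k..<i + k}" using k by (auto simp: overl_def)
  then have "card ?V \<le> 2 * k - 1" using card_mono[of "{i + 1 - k..<i + k}" ?V] by auto
  then have cV: "card ?V + 2 \<le> 2 * k + 1" using k by linarith
  have "p i + (\<Sum>j\<in>overl i. p j) = (\<Sum>j\<in>?V. p j)" by (subst sum.insert) (auto simp: overl_def)
  also have "\<dots> = (\<Sum>j\<in>?V. 1 / 2 ^ (k + 1)) + (\<Sum>j\<in>?V \<inter> {1, n - k + 1}. 1 / 2 ^ (k + 1))"
  proof -
    have "p j = 1 / 2 ^ (k + 1) + (if j \<in> {1, n - k + 1} then 1 / 2 ^ (k + 1) else 0)" for j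
      by (simp add: p_def)
    then have "(\<Sum>j\<in>?V. p j) = (\<Sum>j\<in>?V. 1 / 2 ^ (k + 1) + (if j \<in> {1, n - k + 1} then 1 / 2 ^ (k + 1) else 0))"
      by (intro sum.cong refl)
    also have "\<dots> = (\<Sum>j\<in>?V. 1 / 2 ^ (k + 1)) + (\<Sum>j\<in>?V \<inter> {1, n - k + 1}. 1 / 2 ^ (k + 1))"
      unfolding sum.distrib by (subst sum.inter_restrict[symmetric]) simp_all
    finally show ?thesis .
  qed
  also have "\<dots> = real (card ?V + card (?V \<inter> {1, n - k + 1})) / 2 ^ (k + 1)"
    by (simp add: add_divide_distrib)
  also have "\<dots> \<le> real (2 * k + 1) / 2 ^ (k + 1)"
  proof -
    have "card (?V \<inter> {1, n - k + 1}) \<le> card {1, n - k + 1}" by (intro card_mono) auto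
    also have "\<dots> \<le> 2" by (simp add: card_insert_if)
    finally show ?thesis using cV by (intro divide_right_mono) (simp_all del: of_nat_add)
  qed
  also have "\<dots> \<le> 3 / 4"
  proof -
    have "4 * (2 * k + 1) \<le> 3 * 2 ^ (k + 1)" using k by (induction k rule: dec_induct) auto
    then have "real (4 * (2 * k + 1)) \<le> real (3 * 2 ^ (k + 1))" by (simp only: of_nat_le_iff)
    then show ?thesis by (simp add: field_simps)
  qed
  finally show ?thesis .
qed

lemma sum_p_lower: "real (n - k + 1) / 2 ^ (k + 1) \<le> (\<Sum>i\<in>J. p i)"
proof -
  have "1 / 2 ^ (k + 1) \<le> p i" for i by (auto simp: p_def field_simps)
  from sum_bounded_below[of J, OF this] show ?thesis by (simp add: J_def)
qed

text \<open>Of the sum of the probabilities \<open>p i\<close>, the squares and the overlapping blocks take away at most three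
quarters, and the touching blocks only add to the variance.\<close>

lemma sig2_lower: "(\<Sum>i\<in>J. p i) / 4 \<le> sig2"
  unfolding sig2_def sum_divide_distrib
proof (rule sum_mono)
  fix i assume i: "i \<in> J"
  have "p i * (1 / 4) \<le> p i * (1 - p i - (\<Sum>j\<in>overl i. p j) + nbr_p i)"
    using window_mass[OF i] nbr_p_bounds(1)[of i] p_bounds(1)[of i] by (intro mult_left_mono) auto
  then show "p i / 4 \<le> p i * (1 - p i - (\<Sum>j\<in>overl i. p j) + nbr_p i)" by simp
qed

lemma sig2_pos: "sig2 > 0"
  using sig2_lower sum_p_lower k kn
  by (smt (verit, best) divide_pos_pos of_nat_0_less_iff zero_less_power add_is_0 gr0I zero_neq_one)

lemma sig2_upper: "sig2 \<le> real n"
proof -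
  have "sig2 \<le> (\<Sum>i\<in>J. 1)"
    unfolding sig2_def
  proof (rule sum_mono)
    fix i
    have "(\<Sum>j\<in>overl i. p j) \<ge> 0" by (intro sum_nonneg less_imp_le p_bounds)
    then have "p i * (1 - p i - (\<Sum>j\<in>overl i. p j) + nbr_p i) \<le> (1 / 2) * 2"
      using p_bounds(1,2)[of i] nbr_p_bounds(3)[of i]
      by (intro order.trans[OF mult_left_mono mult_right_mono]) auto
    then show "p i * (1 - p i - (\<Sum>j\<in>overl i. p j) + nbr_p i) \<le> 1" by simp
  qed
  also have "\<dots> \<le> real n" using k kn by (simp add: J_def)
  finally show ?thesis .
qed

section \<open>Moment estimates for the Stein bound\<close>

definition mom3 :: "nat \<Rightarrow> real" where "mom3 i = E (\<lambda>B. \<bar>X i B\<bar> ^ 3)"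

definition mom4 :: "nat \<Rightarrow> real" where "mom4 i = E (\<lambda>B. X i B ^ 4)"

lemma E_ind_affine:
  assumes i: "i \<in> J"
  shows "E (\<lambda>B. ind i B * a + (1 - ind i B) * b) = p i * a + (1 - p i) * b"
  using E_ind[OF i] by simp

lemma moments:
  assumes i: "i \<in> J"
  shows "mom3 i = p i * (1 - p i) * ((p i)^2 + (1 - p i)^2)"
    and "mom4 i = p i * (1 - p i) * (1 - 3 * p i + 3 * (p i)^2)"
proof -
  have "\<bar>X i B\<bar> ^ 3 = ind i B * (1 - p i) ^ 3 + (1 - ind i B) * p i ^ 3"
    and "X i B ^ 4 = ind i B * (1 - p i) ^ 4 + (1 - ind i B) * p i ^ 4" for B
    using ind_01(1)[of i B] p_bounds(1,2)[of i] by (auto simp: X_def)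
  then show "mom3 i = p i * (1 - p i) * ((p i)^2 + (1 - p i)^2)"
    and "mom4 i = p i * (1 - p i) * (1 - 3 * p i + 3 * (p i)^2)"
    unfolding mom3_def mom4_def
    by (simp_all only: E_ind_affine[OF i]) (simp_all add: power2_eq_square power3_eq_cube power4_eq_xxxx algebra_simps)
qed

lemma adj_sum_bounds: "0 \<le> adj_sum i B" "adj_sum i B \<le> real (card (adj i))"
  unfolding adj_sum_def using sum_bounded_above[of "adj i" "\<lambda>j. ind j B" 1] ind_01 by (auto intro: sum_nonneg)

lemma E_ind_adj_sum:
  assumes i: "i \<in> J"
  shows "E (\<lambda>B. ind i B * adj_sum i B) = 2 * p i * nbr_p i"
proof -
  have "E (\<lambda>B. ind i B * adj_sum i B) = (\<Sum>j\<in>adj i. E (\<lambda>B. ind i B * ind j B))"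
    by (simp add: adj_sum_def sum_distrib_left)
  also have "\<dots> = (\<Sum>j\<in>adj i. 2 * p i * p j)"
    by (intro sum.cong refl E_ind_product(2)[OF i]) (use near_subset_J in auto)
  finally show ?thesis by (simp add: nbr_p_def sum_distrib_left)
qed

text \<open>If block \<open>i\<close> occurs, \<open>T i\<close> is the number of occurring blocks that touch it, which is at most \<open>card (adj i)\<close>;
hence its square is at most \<open>card (adj i)\<close> times this number.  Otherwise \<open>\<bar>X i\<bar> = p i\<close> and
\<open>(T i)\<^sup>2 \<le> 1\<close>.\<close>

lemma remainder_bound:
  assumes i: "i \<in> J"
  shows "E (\<lambda>B. \<bar>X i B\<bar> * (T i B)^2) \<le> p i * (1 - p i) * (1 + 2 * real (card (adj i)) * nbr_p i)"
proof -
  let ?c = "real (card (adj i))"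
  have pt: "\<bar>X i B\<bar> * (T i B)^2 \<le> (1 - p i) * ?c * (ind i B * adj_sum i B) + (1 - ind i B) * p i" for B
  proof (cases "ind i B = 1")
    case True
    have "(adj_sum i B)^2 \<le> ?c * adj_sum i B" using adj_sum_bounds[of i B] by (simp add: power2_eq_square mult_right_mono)
    from mult_left_mono[OF this, of "1 - p i"] show ?thesis
      using True T_of_ind_1[OF i True] p_bounds(2)[of i] by (simp add: X_def mult.assoc)
  next
    case False
    then have 0: "ind i B = 0" using ind_01(1) by auto
    have "(T i B)^2 \<le> 1" using T_of_ind_0[OF i 0] by (simp add: abs_square_le_1)
    from mult_left_mono[OF this, of "p i"] show ?thesis
      using 0 p_bounds(1)[of i] by (simp add: X_def)
  qed
  have "E (\<lambda>B. \<bar>X i B\<bar> * (T i B)^2) \<le> E (\<lambda>B. (1 - p i) * ?c * (ind i B * adj_sum i B) + (1 - ind i B) * p i)"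
    by (intro integral_mono pt) simp_all
  also have "\<dots> = (1 - p i) * ?c * (2 * p i * nbr_p i) + (1 - p i) * p i"
    using E_ind[OF i] E_ind_adj_sum[OF i] by simp
  finally show ?thesis by (simp add: algebra_simps)
qed

lemma square_bound:
  assumes i: "i \<in> J"
  shows "E (\<lambda>B. (X i B * T i B)^2) \<le> p i * (1 - p i) * ((1 - p i) * real (card (adj i))^2 + p i)"
proof -
  let ?c = "real (card (adj i))"
  have pt: "(X i B * T i B)^2 \<le> ind i B * ((1 - p i)^2 * ?c^2) + (1 - ind i B) * (p i)^2" for B
  proof (cases "ind i B = 1")
    case True
    have "(adj_sum i B)^2 \<le> ?c^2" using adj_sum_bounds[of i B] by (intro power_mono)
    from mult_left_mono[OF this, of "(1 - p i)^2"] show ?thesis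
      using True T_of_ind_1[OF i True] by (simp add: X_def power_mult_distrib)
  next
    case False
    then have 0: "ind i B = 0" using ind_01(1) by auto
    have "(T i B)^2 \<le> 1" using T_of_ind_0[OF i 0] by (simp add: abs_square_le_1)
    from mult_left_mono[OF this, of "(p i)^2"] show ?thesis
      using 0 by (simp add: X_def power_mult_distrib)
  qed
  have "E (\<lambda>B. (X i B * T i B)^2) \<le> E (\<lambda>B. ind i B * ((1 - p i)^2 * ?c^2) + (1 - ind i B) * (p i)^2)"
    by (intro integral_mono pt) simp_all
  then show ?thesis unfolding E_ind_affine[OF i] by (simp add: power2_eq_square algebra_simps)
qed

text \<open>The factor \<open>6 * k + 1\<close> is the number of summands \<open>X j * T j\<close> that can depend on \<open>X i * T i\<close>, and 56 is half
of the constant 112 with \<open>sqrt 28 * (2 * k) powr (3 / 2) / sqrt pi = sqrt (2 / pi) * sqrt (112 * k ^ 3)\<close>.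
In terms of \<open>q = p i\<close> the claim reduces to a quadratic inequality, with two touching blocks and \<open>q \<le> 1/4\<close> in the interior and with one touching block and \<open>q \<le> 1/2\<close> at the ends.\<close>

lemma square_le_mom4:
  assumes i: "i \<in> J"
  shows "real (6 * k + 1) * E (\<lambda>B. (X i B * T i B)^2) \<le> 56 * real k ^ 3 * mom4 i"
proof -
  define q where "q = p i"
  have q: "0 < q" "q \<le> 1 / 2" using p_bounds by (auto simp: q_def)
  have k1: "real k \<le> real k ^ 3" using k by (intro self_le_power) auto
  moreover have "real (6 * k + 1) \<le> 7 * real k" using k by simp
  ultimately have k7: "real (6 * k + 1) \<le> 7 * real k ^ 3" by (elim order.trans) simp
  have key: "((1 - q) * real (card (adj i))^2 + q) \<le> 8 * (1 - 3 * q + 3 * q^2)"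
  proof (cases "i \<in> {1, n - k + 1}")
    case True
    have "real (card (adj i))^2 \<le> 1^2" using card_adj(2)[OF True] by (intro power_mono) auto
    then have "(1 - q) * real (card (adj i))^2 \<le> (1 - q) * 1" using q by (intro mult_left_mono) auto
    then have "(1 - q) * real (card (adj i))^2 + q \<le> 1" by (simp add: algebra_simps)
    moreover have "0 \<le> (1 - 2 * q)^2" by simp
    then have "1 \<le> 8 * (1 - 3 * q + 3 * q^2)" by (simp add: power2_eq_square algebra_simps)
    ultimately show ?thesis by (rule order.trans)
  next
    case False
    then have q4: "q \<le> 1 / 4" using p_bounds(3) by (simp add: q_def)
    have "real (card (adj i))^2 \<le> 2^2" using card_adj(1)[of i] by (intro power_mono) auto
    then have "(1 - q) * real (card (adj i))^2 \<le> (1 - q) * 4" using q by (intro mult_left_mono) auto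
    then have "(1 - q) * real (card (adj i))^2 + q \<le> 4 - 3 * q" by (simp add: algebra_simps)
    moreover have "0 \<le> (1 / 4 - q) * (15 - 24 * q)" using q4 by (intro mult_nonneg_nonneg) auto
    then have "4 - 3 * q \<le> 8 * (1 - 3 * q + 3 * q^2)" by (simp add: power2_eq_square algebra_simps)
    ultimately show ?thesis by (rule order.trans)
  qed
  have "real (6 * k + 1) * E (\<lambda>B. (X i B * T i B)^2)
      \<le> (7 * real k ^ 3) * (q * (1 - q) * (8 * (1 - 3 * q + 3 * q^2)))"
  proof (rule mult_mono[OF k7])
    have "E (\<lambda>B. (X i B * T i B)^2) \<le> q * (1 - q) * ((1 - q) * real (card (adj i))^2 + q)"
      using square_bound[OF i] by (simp add: q_def)
    also have "\<dots> \<le> q * (1 - q) * (8 * (1 - 3 * q + 3 * q^2))"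
      using q by (intro mult_left_mono key) auto
    finally show "E (\<lambda>B. (X i B * T i B)^2) \<le> q * (1 - q) * (8 * (1 - 3 * q + 3 * q^2))" .
  qed simp_all
  then show ?thesis unfolding moments(2)[OF i] q_def[symmetric] by (simp add: algebra_simps)
qed

end

context block_model
begin

section \<open>The rate of convergence\<close>

lemma ind_local:
  assumes "win j \<subseteq> V" "B \<inter> V = B' \<inter> V"
  shows "ind j B = ind j B'"
  by (rule depends_onD[OF depends_on_mono[OF depends_ind assms(1)] assms(2)])

text \<open>\<open>T i\<close> involves the blocks at \<open>i - k, \<dots>, i + k\<close>.\<close>

lemma depends_summand:
  assumes i: "i \<in> J"
  shows "depends_on {i - (k + 1)..i + 2 * k - 1} (\<lambda>B. X i B * T i B)"
proof (rule depends_onI)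
  let ?V = "{i - (k + 1)..i + 2 * k - 1}"
  fix B B' :: "nat set" assume eq: "B \<inter> ?V = B' \<inter> ?V"
  have near: "ind j B = ind j B'" if "j \<in> near i" for j
    by (rule ind_local[OF _ eq]) (use that k in \<open>auto simp: win_def near_def\<close>)
  have "i \<in> near i" using i by (simp add: near_def)
  from near[OF this] have "X i B = X i B'" by (simp add: X_def)
  moreover have "T i B = T i B'" using near by (simp add: T_def cong: sum.cong)
  ultimately show "X i B * T i B = X i B' * T i B'" by simp
qed

lemma variance_local_products:
  "measure_pmf.variance (coin_pmf coins) (\<lambda>B. \<Sum>i\<in>J. X i B * T i B)
    \<le> 56 * real k ^ 3 * (\<Sum>i\<in>J. mom4 i)"
proof -
  have "measure_pmf.variance (coin_pmf coins) (\<lambda>B. \<Sum>i\<in>J. X i B * T i B)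
      \<le> real (6 * k + 1) * (\<Sum>i\<in>J. E (\<lambda>B. (X i B * T i B)^2))"
  proof (rule variance_sum_local[where dep = "\<lambda>i j. i \<le> j + 3 * k \<and> j \<le> i + 3 * k"])
    fix i j assume ij: "i \<in> J" "j \<in> J" "\<not> (i \<le> j + 3 * k \<and> j \<le> i + 3 * k)"
    show "E (\<lambda>B. X i B * T i B * (X j B * T j B)) = E (\<lambda>B. X i B * T i B) * E (\<lambda>B. X j B * T j B)"
      by (rule coin_E_indep[OF _ depends_summand depends_summand]) (use ij k in auto)
  next
    fix i
    have "{j \<in> J. i \<le> j + 3 * k \<and> j \<le> i + 3 * k} \<subseteq> {i - 3 * k..i + 3 * k}" by auto
    from card_mono[OF _ this] show "card {j \<in> J. i \<le> j + 3 * k \<and> j \<le> i + 3 * k} \<le> 6 * k + 1" by simp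
  qed (auto intro: finite_coin_pmf)
  also have "\<dots> \<le> (\<Sum>i\<in>J. 56 * real k ^ 3 * mom4 i)"
    unfolding sum_distrib_left by (intro sum_mono square_le_mom4)
  finally show ?thesis by (simp add: sum_distrib_left)
qed

text \<open>Up to a constant, \<open>T i\<close> removes from the sum exactly the blocks whose windows meet the window of \<open>i\<close>.\<close>

lemma X_indep_rest:
  assumes i: "i \<in> J"
  shows "E (\<lambda>B. X i B * u ((\<Sum>j\<in>J. X j B) - T i B)) = 0"
proof -
  have rest: "(\<Sum>j\<in>J. X j B) - T i B = (\<Sum>j\<in>J - near i. ind j B) + 1 - (\<Sum>j\<in>J. p j)" for B
  proof -
    have "(\<Sum>j\<in>J. ind j B) = (\<Sum>j\<in>J - near i. ind j B) + (\<Sum>j\<in>near i. ind j B)"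
      by (intro sum.subset_diff near_subset_J) simp
    then show ?thesis unfolding X_def T_def sum_subtractf by linarith
  qed
  have "depends_on (- win i) (\<lambda>B. u ((\<Sum>j\<in>J. X j B) - T i B))"
  proof (rule depends_onI)
    fix B B' :: "nat set" assume eq: "B \<inter> - win i = B' \<inter> - win i"
    have "(\<Sum>j\<in>J - near i. ind j B) = (\<Sum>j\<in>J - near i. ind j B')"
      by (intro sum.cong refl ind_local[OF _ eq]) (use i k in \<open>auto simp: win_def near_def J_def\<close>)
    then show "u ((\<Sum>j\<in>J. X j B) - T i B) = u ((\<Sum>j\<in>J. X j B') - T i B')" by (simp add: rest)
  qed
  moreover have "depends_on (win i) (X i)"
  proof (rule depends_onI)
    fix B B' assume "B \<inter> win i = B' \<inter> win i"
    from depends_onD[OF depends_ind this] show "X i B = X i B'" by (simp add: X_def)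
  qed
  ultimately show ?thesis
    using coin_E_indep[of coins "win i" "X i" "- win i"] E_X[OF i] by simp
qed

lemma half_le_squares: "1 / 2 \<le> (x::real)^2 + (1 - x)^2"
proof -
  have "0 \<le> (1 - 2 * x)^2" by simp
  then show ?thesis by (simp add: power2_eq_square algebra_simps)
qed

lemma remainder_le_mom3:
  assumes k2: "k \<ge> 2"
  shows "(\<Sum>i\<in>J. E (\<lambda>B. \<bar>X i B\<bar> * (T i B)^2)) \<le> 4 * real k ^ 2 * (\<Sum>i\<in>J. mom3 i)"
  unfolding sum_distrib_left
proof (rule sum_mono)
  fix i assume i: "i \<in> J"
  let ?c = "real (card (adj i))"
  have c: "?c \<le> 2" using card_adj(1)[of i] by simp
  have "(2::real)^2 \<le> 2 ^ k" using k2 by (intro power_increasing) auto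
  then have "?c / 2 ^ k \<le> 2 / 4" using c by (intro frac_le) auto
  then have "nbr_p i \<le> 2 / 4" by (rule order.trans[OF nbr_p_bounds(2)])
  then have "?c * nbr_p i \<le> 2 * (2 / 4)" using c nbr_p_bounds(1)[of i] by (intro mult_mono) auto
  then have "1 + 2 * ?c * nbr_p i \<le> (4 * 2^2) * (1 / 2)" by simp
  also have "\<dots> \<le> (4 * real k ^ 2) * ((p i)^2 + (1 - p i)^2)"
  proof (rule mult_mono)
    show "4 * 2^2 \<le> 4 * real k ^ 2" using k2 by (intro mult_left_mono power_mono) auto
  qed (rule half_le_squares, auto)
  finally have "p i * (1 - p i) * (1 + 2 * ?c * nbr_p i) \<le> p i * (1 - p i) * (4 * real k ^ 2 * ((p i)^2 + (1 - p i)^2))"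
    using p_bounds(1,2)[of i] by (intro mult_left_mono) auto
  with remainder_bound[OF i] show "E (\<lambda>B. \<bar>X i B\<bar> * (T i B)^2) \<le> 4 * real k ^ 2 * mom3 i"
    by (simp add: moments(1)[OF i] ac_simps)
qed

lemma fixed_point_model:
  assumes k1: "k = 1"
  shows "J = {1..n}" "n \<ge> 2" "p i = (if i \<in> {1, n} then 1 / 2 else 1 / 4)"
    and "i \<in> J \<Longrightarrow> i \<notin> {1, n} \<Longrightarrow> adj i = {i - 1, i + 1}"
    and "overl i = {}"
proof -
  have n: "n - k + 1 = n" "n \<ge> 2" using k1 kn by auto
  show J: "J = {1..n}" unfolding J_def n(1) ..
  show "n \<ge> 2" by fact
  show "p i = (if i \<in> {1, n} then 1 / 2 else 1 / 4)" unfolding p_def n(1) unfolding k1 by simp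
  show "adj i = {i - 1, i + 1}" if "i \<in> J" "i \<notin> {1, n}"
    using that unfolding adj_def J unfolding k1 by auto
  show "overl i = {}" unfolding overl_def unfolding k1 by auto
qed

text \<open>The bound for an interior position exceeds \<open>4 * mom3 i\<close> by \<open>3/32\<close>, and by \<open>3/16\<close> more for each neighbour that is an end,
because ends have the larger probability \<open>1/2\<close>.\<close>

lemma remainder_fixed_points:
  assumes k1: "k = 1"
  shows "(\<Sum>i\<in>J. E (\<lambda>B. \<bar>X i B\<bar> * (T i B)^2)) \<le> 4 * (\<Sum>i\<in>J. mom3 i) + 3 * real n / 16"
proof -
  note s = fixed_point_model[OF k1]
  \<comment> \<open>At an end there is at most one touching block, and then \<open>4 * mom3 i\<close> suffices.\<close>
  define ex where "ex i = (if i \<in> {1, n} then 0 else 3 / 16 * (1 / 2 + of_bool (i = 2) + of_bool (i = n - 1)) :: real)" for i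
  have bnd: "E (\<lambda>B. \<bar>X i B\<bar> * (T i B)^2) \<le> 4 * mom3 i + ex i" if i: "i \<in> J" for i
  proof (cases "i \<in> {1, n}")
    case True
    then have pi: "p i = 1 / 2" by (simp add: s)
    have nk: "n - k + 1 = n" using k1 kn by simp
    have c: "real (card (adj i)) \<le> 1" using card_adj(2)[of i, unfolded nk, OF True] by simp
    have "real (card (adj i)) / 2 ^ k = real (card (adj i)) / 2" unfolding k1 by simp
    with c nbr_p_bounds(2)[of i] have "nbr_p i \<le> 1 / 2" by linarith
    then have "real (card (adj i)) * nbr_p i \<le> 1 * (1 / 2)"
      using c nbr_p_bounds(1)[of i] by (intro mult_mono) auto
    then show ?thesis using remainder_bound[OF i] True
      by (simp add: moments(1)[OF i] pi ex_def power2_eq_square)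
  next
    case False
    then have pi: "p i = 1 / 4" by (simp add: s)
    have adj: "adj i = {i - 1, i + 1}" by (rule s(4)[OF i False])
    have ne: "i - 1 \<noteq> i + 1" by simp
    from adj ne have nbr: "nbr_p i = p (i - 1) + p (i + 1)" and c: "card (adj i) = 2"
      by (simp_all add: nbr_p_def del: One_nat_def)
    have "i \<ge> 2" "i + 1 \<le> n" using i False unfolding s(1) by auto
    then have "p (i - 1) = 1 / 4 + of_bool (i = 2) / 4" "p (i + 1) = 1 / 4 + of_bool (i = n - 1) / 4"
      unfolding s(3) by auto
    moreover define d :: real where "d = of_bool (i = 2) + of_bool (i = n - 1)"
    ultimately have nbr': "nbr_p i = 1 / 2 + d / 4" using nbr by simp
    have "ex i = 3 / 16 * (1 / 2 + d)" using False by (simp add: ex_def d_def)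
    moreover have "mom3 i = 3 / 16 * (10 / 16)" unfolding moments(1)[OF i] pi by (simp add: power2_eq_square)
    moreover have "E (\<lambda>B. \<bar>X i B\<bar> * (T i B)^2) \<le> 3 / 16 * (3 + d)"
      using remainder_bound[OF i] unfolding pi c nbr' by (simp add: algebra_simps)
    ultimately show ?thesis by simp
  qed
  have "(\<Sum>i\<in>J. ex i) \<le> 3 * real n / 16"
  proof (cases "n = 2")
    case True
    then have "ex i = 0" if "i \<in> J" for i using that unfolding s(1) by (auto simp: ex_def)
    then show ?thesis by simp
  next
    case False
    then have n3: "n \<ge> 3" using s(2) by simp
    have "(\<Sum>i\<in>J. ex i) = (\<Sum>i\<in>J - {1, n}. 3 / 16 * (1 / 2 + of_bool (i = 2) + of_bool (i = n - 1)))"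
      by (rule sum.mono_neutral_cong_right) (auto simp: ex_def)
    also have "\<dots> = 3 / 16 * (real (card (J - {1, n})) / 2 + (\<Sum>i\<in>J - {1, n}. of_bool (i = 2)) + (\<Sum>i\<in>J - {1, n}. of_bool (i = n - 1)))"
      by (simp only: sum.distrib sum_distrib_left[symmetric]) simp
    also have "\<dots> \<le> 3 / 16 * ((real n - 2) / 2 + 1 + 1)"
    proof (intro mult_left_mono add_mono)
      have one: "(\<Sum>i\<in>S. of_bool (i = m)) \<le> (1::real)" if "finite S" for S :: "nat set" and m
      proof -
        have "card (S \<inter> {i. i = m}) \<le> card {m}" by (rule card_mono) auto
        then show ?thesis using that by simp
      qed
      show "(\<Sum>i\<in>J - {1, n}. of_bool (i = 2)) \<le> (1::real)" "(\<Sum>i\<in>J - {1, n}. of_bool (i = n - 1)) \<le> (1::real)"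
        by (rule one, simp)+
      have "card (J - {1, n}) = n - 2" using n3 unfolding s(1) by (subst card_Diff_subset) auto
      then show "real (card (J - {1, n})) / 2 \<le> (real n - 2) / 2" using n3 by simp
    qed simp
    also have "\<dots> \<le> 3 * real n / 16" using n3 by (simp add: field_simps)
    finally show ?thesis .
  qed
  moreover have "(\<Sum>i\<in>J. E (\<lambda>B. \<bar>X i B\<bar> * (T i B)^2)) \<le> (\<Sum>i\<in>J. 4 * mom3 i + ex i)"
    by (intro sum_mono bnd)
  ultimately show ?thesis by (simp add: sum.distrib sum_distrib_left)
qed

lemma fixed_points_lower:
  assumes k1: "k = 1"
  shows "3 * real n / 16 \<le> sig2" "real n / 16 \<le> (\<Sum>i\<in>J. mom4 i)"
proof -
  note s = fixed_point_model[OF k1]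
  have pi: "p i = 1 / 2 \<or> p i = 1 / 4" for i by (simp add: s)
  have card: "real (card J) = real n" by (simp add: s)
  have "3 / 16 \<le> p i * (1 - p i - (\<Sum>j\<in>overl i. p j) + nbr_p i)" for i
  proof -
    have "p i * (1 - p i) \<le> p i * (1 - p i - (\<Sum>j\<in>overl i. p j) + nbr_p i)"
      using p_bounds(1)[of i] nbr_p_bounds(1)[of i] by (intro mult_left_mono) (auto simp: s(5))
    moreover have "3 / 16 \<le> p i * (1 - p i)" using pi[of i] by (elim disjE) (simp_all only:, simp_all)
    ultimately show ?thesis by linarith
  qed
  then have "real (card J) * (3 / 16) \<le> sig2" unfolding sig2_def by (intro sum_bounded_below)
  then show "3 * real n / 16 \<le> sig2" unfolding card by simp
  have "1 / 16 \<le> mom4 i" if "i \<in> J" for i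
    using pi[of i] unfolding moments(2)[OF that]
    by (elim disjE) (simp_all only:, simp_all add: power2_eq_square)
  then have "real (card J) * (1 / 16) \<le> (\<Sum>i\<in>J. mom4 i)" by (intro sum_bounded_below)
  then show "real n / 16 \<le> (\<Sum>i\<in>J. mom4 i)" unfolding card by simp
qed

text \<open>The bound of the theorem in the quantities of the coin model.\<close>

definition stein_rate :: real where
  "stein_rate = 4 * real k ^ 2 / sqrt sig2 ^ 3 * (\<Sum>i\<in>J. mom3 i)
     + sqrt 28 * (2 * real k) powr (3 / 2) / (sqrt pi * sqrt sig2 ^ 2) * sqrt (\<Sum>i\<in>J. mom4 i)"

text \<open>With \<open>q / \<sigma>\<^sup>2\<close> for the second summand of the rate, the variance term of \<open>stein_bound_local\<close> uses at
most three quarters of it, as \<open>sqrt (1/2) \<le> 3/4\<close>.  The remaining quarter covers the excess \<open>e\<close> of the first summand,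
which is nonzero only for fixed points.\<close>

lemma stein_rate_bound:
  assumes lip: "1-lipschitz_on UNIV h"
  shows "\<bar>E (\<lambda>B. h (1 / sqrt sig2 * (\<Sum>i\<in>J. X i B))) - gauss_mean h\<bar> \<le> stein_rate"
proof -
  define \<sigma> where "\<sigma> = sqrt sig2"
  have \<sigma>: "\<sigma> > 0" "\<sigma>^2 = sig2" using sig2_pos by (auto simp: \<sigma>_def)
  define b where "b = (\<Sum>i\<in>J. mom4 i)"
  define q where "q = sqrt (224 * real k ^ 3 * b / pi)"
  define V where "V = measure_pmf.variance (coin_pmf coins) (\<lambda>B. \<Sum>i\<in>J. X i B * T i B)"
  define R where "R = (\<Sum>i\<in>J. E (\<lambda>B. \<bar>X i B\<bar> * (T i B)^2))"
  define a where "a = (\<Sum>i\<in>J. mom3 i)"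
  have b: "b \<ge> 0" unfolding b_def mom4_def by (intro sum_nonneg) simp
  have main: "\<bar>E (\<lambda>B. h (1 / \<sigma> * (\<Sum>i\<in>J. X i B))) - gauss_mean h\<bar>
      \<le> R / \<sigma>^3 + sqrt (2 / pi) / \<sigma>^2 * sqrt V"
    unfolding R_def V_def
  proof (rule stein_bound_local)
    show "E (\<lambda>B. \<Sum>i\<in>J. X i B * T i B) = \<sigma>^2" unfolding \<sigma>(2) by (rule E_sum_X_T)
    show "E (\<lambda>B. X i B * u ((\<Sum>j\<in>J. X j B) - T i B)) = 0" if "i \<in> J" for i u
      by (rule X_indep_rest[OF that])
  qed (simp_all add: finite_coin_pmf \<sigma>(1) lip)
  have second: "sqrt 28 * (2 * real k) powr (3 / 2) / (sqrt pi * \<sigma>^2) * sqrt b = q / \<sigma>^2"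
  proof -
    have "(2 * real k) powr (3 / 2) = sqrt ((2 * real k) ^ 3)"
      using k powr_powr[of "2 * real k" 3 "1 / 2"] powr_half_sqrt[of "(2 * real k) ^ 3"] by simp
    then have "sqrt 28 * (2 * real k) powr (3 / 2) / sqrt pi * sqrt b
        = sqrt (28 * (2 * real k) ^ 3 / pi * b)"
      by (simp only: real_sqrt_mult real_sqrt_divide)
    also have "28 * (2 * real k) ^ 3 / pi * b = 224 * real k ^ 3 * b / pi" by (simp add: power_mult_distrib)
    finally have "sqrt 28 * (2 * real k) powr (3 / 2) / sqrt pi * sqrt b = q" by (simp only: q_def)
    moreover have "x / (sqrt pi * \<sigma>^2) * y = x / sqrt pi * y / \<sigma>^2" for x y by simp
    ultimately show ?thesis by (simp only:)
  qed
  have V: "sqrt (2 / pi) / \<sigma>^2 * sqrt V \<le> 3 / 4 * q / \<sigma>^2"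
  proof -
    have "V \<le> 63 * real k ^ 3 * b"
    proof -
      have "V \<le> 56 * (real k ^ 3 * b)" using variance_local_products by (simp add: V_def b_def mult.assoc)
      also have "\<dots> \<le> 63 * (real k ^ 3 * b)" using b by (intro mult_right_mono) auto
      finally show ?thesis by (simp add: mult.assoc)
    qed
    then have "2 / pi * V \<le> 2 / pi * (63 * real k ^ 3 * b)" by (intro mult_left_mono) auto
    also have "\<dots> = (3 / 4)^2 * (224 * real k ^ 3 * b / pi)" by (simp add: power2_eq_square)
    finally have "sqrt (2 / pi * V) \<le> sqrt ((3 / 4)^2 * (224 * real k ^ 3 * b / pi))"
      by (rule real_sqrt_le_mono)
    moreover have "sqrt ((3 / 4)^2 * y) = 3 / 4 * sqrt y" for y by (simp add: real_sqrt_mult)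
    ultimately have "sqrt (2 / pi) * sqrt V \<le> 3 / 4 * q"
      unfolding q_def by (simp only: real_sqrt_mult[of "2 / pi" V])
    from divide_right_mono[OF this, of "\<sigma>^2"] show ?thesis by simp
  qed
  define e where "e = (if k = 1 then 3 * real n / 16 else 0)"
  have R_le: "R \<le> 4 * real k ^ 2 * a + e"
  proof (cases "k = 1")
    case True
    then have "e = 3 * real n / 16" "4 * real k ^ 2 = 4" by (simp_all add: e_def)
    with remainder_fixed_points[OF True] show ?thesis by (simp add: R_def a_def)
  next
    case False
    then have "e = 0" "k \<ge> 2" using k by (simp_all add: e_def)
    with remainder_le_mom3 show ?thesis by (simp add: R_def a_def)
  qed
  have "4 * e \<le> \<sigma> * q"
  proof (cases "k = 1")
    case True
    then have e: "e = 3 * real n / 16" and k3: "real k ^ 3 = 1" by (simp_all add: e_def)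
    have q2: "q^2 = 224 * b / pi" and q0: "q \<ge> 0" unfolding q_def k3 using b by simp_all
    have "(3 * real n / 16) * (real n / 16) \<le> \<sigma>^2 * b"
      unfolding b_def by (rule mult_mono) (use fixed_points_lower[OF True] \<sigma> in auto)
    moreover have "(4 * e)^2 \<le> 56 * ((3 * real n / 16) * (real n / 16))"
      unfolding e power2_eq_square by simp
    moreover have "56 * (\<sigma>^2 * b) \<le> (224 / pi) * (\<sigma>^2 * b)"
    proof (rule mult_right_mono)
      show "56 \<le> 224 / pi" using pi_less_4 pi_gt_zero by (simp add: pos_le_divide_eq)
    qed (use b in simp)
    moreover have "(224 / pi) * (\<sigma>^2 * b) = (\<sigma> * q)^2" by (simp add: q2 power_mult_distrib)
    ultimately have "(4 * e)^2 \<le> (\<sigma> * q)^2" by linarith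
    then show ?thesis by (rule power2_le_imp_le) (use \<sigma> q0 in simp)
  next
    case False
    then have "e = 0" by (simp add: e_def)
    then show ?thesis using \<sigma> b by (simp add: q_def)
  qed
  then have "e / \<sigma>^3 \<le> (\<sigma> * q / 4) / \<sigma>^3" using \<sigma>(1) by (intro divide_right_mono) auto
  also have "\<dots> = 1 / 4 * q / \<sigma>^2" using \<sigma>(1) by (simp add: power2_eq_square power3_eq_cube)
  finally have e_le: "e / \<sigma>^3 \<le> 1 / 4 * q / \<sigma>^2" .
  have "R / \<sigma>^3 \<le> (4 * real k ^ 2 * a + e) / \<sigma>^3"
    using R_le \<sigma>(1) by (intro divide_right_mono) auto
  then have first: "R / \<sigma>^3 \<le> 4 * real k ^ 2 / \<sigma>^3 * a + e / \<sigma>^3" by (simp add: add_divide_distrib)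
  have rate: "stein_rate = 4 * real k ^ 2 / \<sigma>^3 * a + q / \<sigma>^2"
    unfolding stein_rate_def \<sigma>_def[symmetric] a_def[symmetric] b_def[symmetric] second ..
  have "q / \<sigma>^2 = 3 / 4 * q / \<sigma>^2 + 1 / 4 * q / \<sigma>^2" by simp
  then show ?thesis using main V e_le first unfolding rate \<sigma>_def[symmetric] by linarith
qed

end

context block_model
begin

section \<open>From coins back to permutations\<close>

lemma shifted_ind_perm_of:
  assumes "B \<subseteq> coins" "i \<in> J"
  shows "shifted_ind n k i (perm_of n B) = X i B"
proof -
  have "occurs_I k i (perm_of n B) \<longleftrightarrow> block_at n k i B"
    using assms k kn by (intro occurs_perm_of) (auto simp: coins_def J_def)
  then show ?thesis by (simp add: shifted_ind_def X_def p_def ind_def)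
qed

lemma expectation_unif_b2:
  fixes f :: "(nat \<Rightarrow> nat) \<Rightarrow> real"
  shows "measure_pmf.expectation (unif_b2 n) f = E (\<lambda>B. f (perm_of n B))"
  unfolding unif_b2_eq by (simp add: coins_def)

lemma sigma_nk_eq: "sigma_nk n k = sqrt sig2"
proof -
  have count: "real (num_cycles n k (perm_of n B)) = (\<Sum>i\<in>J. ind i B)" if "B \<subseteq> coins" for B
    using that num_cycles_perm_of[of B n k] k kn by (simp add: coins_def J_def ind_def)
  have mean: "E (\<lambda>B. real (num_cycles n k (perm_of n B))) = E (\<lambda>B. \<Sum>i\<in>J. ind i B)"
    by (rule coin_E_cong) (simp_all only: finite_coins_J count)
  have "measure_pmf.variance (unif_b2 n) (\<lambda>\<pi>. real (num_cycles n k \<pi>))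
      = E (\<lambda>B. (real (num_cycles n k (perm_of n B)) - E (\<lambda>B. \<Sum>i\<in>J. ind i B))^2)"
    unfolding expectation_unif_b2 mean ..
  also have "\<dots> = measure_pmf.variance (coin_pmf coins) (\<lambda>B. \<Sum>i\<in>J. ind i B)"
    by (rule coin_E_cong) (simp_all only: finite_coins_J count)
  finally show ?thesis unfolding sigma_nk_def variance_count by simp
qed

lemma a_nk_eq: "a_nk n k = (\<Sum>i\<in>J. mom3 i)"
  unfolding a_nk_def J_def[symmetric] expectation_unif_b2 mom3_def
  by (intro sum.cong refl coin_E_cong) (simp_all only: finite_coins_J shifted_ind_perm_of)

lemma b_nk_eq: "b_nk n k = (\<Sum>i\<in>J. mom4 i)"
  unfolding b_nk_def J_def[symmetric] expectation_unif_b2 mom4_def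
  by (intro sum.cong refl coin_E_cong) (simp_all only: finite_coins_J shifted_ind_perm_of)

lemma wasserstein_bound_eq: "wasserstein_bound n k = stein_rate"
  unfolding wasserstein_bound_def stein_rate_def sigma_nk_eq a_nk_eq b_nk_eq ..

lemma expectation_W_nk:
  "measure_pmf.expectation (unif_b2 n) (\<lambda>\<pi>. h (W_nk n k \<pi>)) = E (\<lambda>B. h (1 / sqrt sig2 * (\<Sum>i\<in>J. X i B)))"
  unfolding expectation_unif_b2 W_nk_def J_def[symmetric] sigma_nk_eq
  by (rule coin_E_cong) (simp_all only: finite_coins_J shifted_ind_perm_of cong: sum.cong)

lemma wasserstein_le:
  assumes Z: "distributed N lborel Z (\<lambda>x. ennreal (std_normal_density x))"
  shows "wasserstein_dist (measure_pmf (unif_b2 n)) (W_nk n k) N Z \<le> ennreal (wasserstein_bound n k)"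
  unfolding wasserstein_dist_def
proof (rule SUP_least)
  fix h :: "real \<Rightarrow> real" assume "h \<in> {h. 1-lipschitz_on UNIV h}"
  then have lip: "1-lipschitz_on UNIV h" by simp
  have "h \<in> borel_measurable lborel"
    using borel_measurable_continuous_onI[OF lipschitz_on_continuous_on[OF lip]] by simp
  then have "(\<integral>y. h (Z y) \<partial>N) = (\<integral>x. phi x * h x \<partial>lborel)"
    by (intro distributed_integral[OF Z, symmetric]) simp_all
  then have "(\<integral>y. h (Z y) \<partial>N) = gauss_mean h" by (simp add: gauss_mean_def mult.commute)
  then show "ennreal \<bar>(\<integral>x. h (W_nk n k x) \<partial>measure_pmf (unif_b2 n)) - (\<integral>y. h (Z y) \<partial>N)\<bar>
      \<le> ennreal (wasserstein_bound n k)"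
    unfolding wasserstein_bound_eq expectation_W_nk
    by (intro ennreal_leI) (simp only: stein_rate_bound[OF lip])
qed

text \<open>Because \<open>k < n\<close>, the two end positions are different.\<close>

lemma sum_J_p:
  "(\<Sum>i\<in>J. g (p i)) = 2 * g (1 / 2 ^ k) + (real n - real k - 1) * (g (1 / 2 ^ (k + 1)) :: real)"
proof -
  let ?m = "n - k + 1"
  have m: "?m \<noteq> 1" "{1, ?m} \<subseteq> J" using kn by (auto simp: J_def)
  have card: "real (card (J - {1, ?m})) = real n - real k - 1"
    using kn m by (subst card_Diff_subset) (auto simp: J_def)
  have "(\<Sum>i\<in>J. g (p i)) = (\<Sum>i\<in>J - {1, ?m}. g (p i)) + (\<Sum>i\<in>{1, ?m}. g (p i))"
    by (rule sum.subset_diff[OF m(2)]) simp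
  also have "(\<Sum>i\<in>J - {1, ?m}. g (p i)) = (\<Sum>i\<in>J - {1, ?m}. g (1 / 2 ^ (k + 1)))"
    by (intro sum.cong refl) (simp add: p_def)
  also have "\<dots> = (real n - real k - 1) * g (1 / 2 ^ (k + 1))" unfolding sum_constant card ..
  also have "(\<Sum>i\<in>{1, ?m}. g (p i)) = 2 * g (1 / 2 ^ k)" using m by (simp add: p_def)
  finally show ?thesis by simp
qed

end

section \<open>Closed forms and asymptotics\<close>

lemma mu3_pow2:
  fixes l :: nat
  defines "q \<equiv> 1 / 2 ^ l :: real"
  shows "q * (1 - q) * (q^2 + (1 - q)^2) = (2 ^ (3 * l) - 3 * 2 ^ (2 * l) + 2 ^ (l + 2) - 2) / 2 ^ (4 * l)"
proof -
  have gen: "1 / x * (1 - 1 / x) * ((1 / x)^2 + (1 - 1 / x)^2) = (x^3 - 3 * x^2 + x * 4 - 2) / x^4"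
    if "x > 0" for x :: real
    using that by (simp add: field_simps power2_eq_square power3_eq_cube power4_eq_xxxx)
  have "2 ^ (3 * l) = ((2::real) ^ l)^3" "2 ^ (2 * l) = ((2::real) ^ l)^2" "2 ^ (4 * l) = ((2::real) ^ l)^4"
    by (simp_all add: power_mult[symmetric] mult.commute)
  moreover have "(2::real) ^ (l + 2) = 2 ^ l * 4" by (simp add: power_add)
  ultimately show ?thesis using gen[of "2 ^ l"] unfolding q_def by simp
qed

lemma mu4_pow2:
  fixes l :: nat
  defines "q \<equiv> 1 / 2 ^ l :: real"
  shows "q * (1 - q) * (1 - 3 * q + 3 * q^2) = (2 ^ (2 * l) - 3 * 2 ^ l + 3) * (2 ^ l - 1) / 2 ^ (4 * l)"
proof -
  have gen: "1 / x * (1 - 1 / x) * (1 - 3 * (1 / x) + 3 * (1 / x)^2) = (x^2 - 3 * x + 3) * (x - 1) / x^4"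
    if "x > 0" for x :: real
    using that by (simp add: field_simps power2_eq_square power3_eq_cube power4_eq_xxxx)
  have "2 ^ (2 * l) = ((2::real) ^ l)^2" "2 ^ (4 * l) = ((2::real) ^ l)^4"
    by (simp_all add: power_mult[symmetric] mult.commute)
  then show ?thesis using gen[of "2 ^ l"] unfolding q_def by simp
qed

text \<open>The third absolute and the fourth central moment of a Bernoulli variable with success probability \<open>q\<close>.\<close>

definition mu3 :: "real \<Rightarrow> real" where "mu3 q = q * (1 - q) * (q^2 + (1 - q)^2)"

definition mu4 :: "real \<Rightarrow> real" where "mu4 q = q * (1 - q) * (1 - 3 * q + 3 * q^2)"

lemma mu_pos:
  assumes "0 < q" "q < 1"
  shows "mu3 q > 0" "mu4 q > 0"
proof -
  have "0 < q^2 + (1 - q)^2" using assms by (intro add_pos_pos) auto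
  then show "mu3 q > 0" using assms by (simp add: mu3_def)
  have "0 \<le> (1 - 2 * q)^2" by simp
  then have "0 < 1 - 3 * q + 3 * q^2" by (simp add: power2_eq_square algebra_simps)
  then show "mu4 q > 0" using assms by (simp add: mu4_def)
qed

lemma moment_sums_closed:
  assumes "1 \<le> k" "k < n"
  shows "a_nk n k = 2 * mu3 (1 / 2 ^ k) + (real n - real k - 1) * mu3 (1 / 2 ^ (k + 1))"
    and "b_nk n k = 2 * mu4 (1 / 2 ^ k) + (real n - real k - 1) * mu4 (1 / 2 ^ (k + 1))"
proof -
  interpret block_model n k using assms by unfold_locales
  show "a_nk n k = 2 * mu3 (1 / 2 ^ k) + (real n - real k - 1) * mu3 (1 / 2 ^ (k + 1))"
    unfolding a_nk_eq sum_J_p[symmetric] by (intro sum.cong refl) (simp add: moments mu3_def)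
  show "b_nk n k = 2 * mu4 (1 / 2 ^ k) + (real n - real k - 1) * mu4 (1 / 2 ^ (k + 1))"
    unfolding b_nk_eq sum_J_p[symmetric] by (intro sum.cong refl) (simp add: moments mu4_def)
qed

lemma affine_bigtheta:
  fixes c d :: real and k :: nat
  assumes "d > 0"
  shows "(\<lambda>n. c + (real n - real k - 1) * d) \<in> \<Theta>(\<lambda>n. real n)"
  using assms by real_asymp

lemma moment_sums_bigtheta:
  assumes k: "1 \<le> k"
  shows "(\<lambda>n. a_nk n k) \<in> \<Theta>(\<lambda>n. real n)" "(\<lambda>n. b_nk n k) \<in> \<Theta>(\<lambda>n. real n)"
proof -
  have "(1::real) < 2 ^ (k + 1)" by (rule one_less_power) auto
  then have q: "0 < 1 / (2::real) ^ (k + 1)" "1 / (2::real) ^ (k + 1) < 1" by (auto simp: field_simps)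
  have "\<forall>\<^sub>F n in at_top. a_nk n k = 2 * mu3 (1 / 2 ^ k) + (real n - real k - 1) * mu3 (1 / 2 ^ (k + 1))"
    using eventually_gt_at_top[of k] by eventually_elim (rule moment_sums_closed[OF k])
  then show "(\<lambda>n. a_nk n k) \<in> \<Theta>(\<lambda>n. real n)"
    by (rule landau_theta.in_cong[THEN iffD2]) (rule affine_bigtheta[OF mu_pos(1)[OF q]])
  have "\<forall>\<^sub>F n in at_top. b_nk n k = 2 * mu4 (1 / 2 ^ k) + (real n - real k - 1) * mu4 (1 / 2 ^ (k + 1))"
    using eventually_gt_at_top[of k] by eventually_elim (rule moment_sums_closed[OF k])
  then show "(\<lambda>n. b_nk n k) \<in> \<Theta>(\<lambda>n. real n)"
    by (rule landau_theta.in_cong[THEN iffD2]) (rule affine_bigtheta[OF mu_pos(2)[OF q]])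
qed

text \<open>The lower bound for the variance is proportional to the number \<open>n - k + 1\<close> of positions, which exceeds
\<open>n / 2\<close> once \<open>n \<ge> 2 * k\<close>.\<close>

lemma sigma_nk_bigtheta:
  assumes k: "1 \<le> k"
  shows "(\<lambda>n. sigma_nk n k ^ 2) \<in> \<Theta>(\<lambda>n. real n)"
proof (rule bigthetaI)
  have bounds: "sigma_nk n k ^ 2 \<le> real n" "real (n - k + 1) / 2 ^ (k + 1) / 4 \<le> sigma_nk n k ^ 2"
    if "k < n" for n
  proof -
    interpret block_model n k using k that by unfold_locales
    have "sigma_nk n k ^ 2 = sig2" using sig2_pos by (simp add: sigma_nk_eq)
    then show "sigma_nk n k ^ 2 \<le> real n" "real (n - k + 1) / 2 ^ (k + 1) / 4 \<le> sigma_nk n k ^ 2"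
      using sig2_upper order.trans[OF divide_right_mono[OF sum_p_lower] sig2_lower] by simp_all
  qed
  show "(\<lambda>n. sigma_nk n k ^ 2) \<in> O(\<lambda>n. real n)"
    using bounds(1) by (intro landau_o.bigI[of 1] eventually_mono[OF eventually_gt_at_top[of k]]) auto
  show "(\<lambda>n. sigma_nk n k ^ 2) \<in> \<Omega>(\<lambda>n. real n)"
  proof (rule landau_omega.bigI[of "1 / (2 ^ (k + 1) * 4 * 2)"])
    show "\<forall>\<^sub>F n in at_top. 1 / (2 ^ (k + 1) * 4 * 2) * norm (real n) \<le> norm (sigma_nk n k ^ 2)"
      using eventually_ge_at_top[of "2 * k + 1"]
    proof eventually_elim
      case (elim n)
      have "real n / 2 \<le> real (n - k + 1)" using elim by linarith
      then have "real n / 2 / 2 ^ (k + 1) / 4 \<le> real (n - k + 1) / 2 ^ (k + 1) / 4"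
        by (intro divide_right_mono) auto
      also have "\<dots> \<le> sigma_nk n k ^ 2" using bounds(2) elim by simp
      finally show ?case by (simp add: field_simps)
    qed
  qed simp
qed

text \<open>Both summands are nonnegative and of order \<open>n powr (- 1 / 2)\<close>: the first is \<open>n / n powr (3 / 2)\<close>, the
second \<open>n powr (1 / 2) / n\<close>.\<close>

lemma wasserstein_bound_bigtheta:
  assumes k: "1 \<le> k"
  shows "(\<lambda>n. wasserstein_bound n k) \<in> \<Theta>(\<lambda>n. real n powr (- 1 / 2))"
proof -
  have nonneg: "sigma_nk n k \<ge> 0" "a_nk n k \<ge> 0" "b_nk n k \<ge> 0" for n
  proof -
    show "sigma_nk n k \<ge> 0" unfolding sigma_nk_def by simp
    show "a_nk n k \<ge> 0" "b_nk n k \<ge> 0" unfolding a_nk_def b_nk_def by (intro sum_nonneg; simp)+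
  qed
  have half: "(\<lambda>n. sqrt (f n)) \<in> \<Theta>(\<lambda>n. real n powr (1 / 2))"
    if "f \<in> \<Theta>(\<lambda>n. real n)" "\<And>n. f n \<ge> 0" for f :: "nat \<Rightarrow> real"
    using bigtheta_powr[OF that(1), of "1 / 2"] that(2) by (simp add: powr_half_sqrt)
  have \<sigma>: "(\<lambda>n. sigma_nk n k) \<in> \<Theta>(\<lambda>n. real n powr (1 / 2))"
    using half[OF sigma_nk_bigtheta[OF k]] nonneg(1) by simp
  have pos: "\<forall>\<^sub>F n in at_top. sigma_nk n k \<noteq> 0"
  proof (rule eventually_mono[OF eventually_gt_at_top[of k]])
    fix n assume "k < n"
    then interpret block_model n k using k by unfold_locales
    show "sigma_nk n k \<noteq> 0" using sig2_pos by (simp add: sigma_nk_eq)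
  qed
  have sym: "(\<lambda>n. real n powr (1 / 2)) \<in> \<Theta>(\<lambda>n. sigma_nk n k)" "real \<in> \<Theta>(\<lambda>n. sigma_nk n k ^ 2)"
    using \<sigma> sigma_nk_bigtheta[OF k] by (simp_all add: bigtheta_sym)
  have "(\<lambda>n. 4 * real k ^ 2 / (sigma_nk n k * sigma_nk n k ^ 2) * a_nk n k)
      \<in> \<Theta>(\<lambda>n. 1 / (real n powr (1 / 2) * real n) * real n)"
    using k pos sym by (intro landau_theta.mult landau_theta.divide \<sigma> sigma_nk_bigtheta moment_sums_bigtheta) auto
  moreover have "sigma_nk n k * sigma_nk n k ^ 2 = sigma_nk n k ^ 3" for n
    by (simp add: power2_eq_square power3_eq_cube)
  ultimately have "(\<lambda>n. 4 * real k ^ 2 / sigma_nk n k ^ 3 * a_nk n k)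
      \<in> \<Theta>(\<lambda>n. 1 / (real n powr (1 / 2) * real n) * real n)"
    by simp
  also have "(\<lambda>n. 1 / (real n powr (1 / 2) * real n) * real n) \<in> \<Theta>(\<lambda>n. real n powr (- 1 / 2))" by real_asymp
  finally have 1: "(\<lambda>n. 4 * real k ^ 2 / sigma_nk n k ^ 3 * a_nk n k) \<in> \<Theta>(\<lambda>n. real n powr (- 1 / 2))" .
  let ?f2 = "\<lambda>n. sqrt 28 * (2 * real k) powr (3 / 2) / (sqrt pi * sigma_nk n k ^ 2) * sqrt (b_nk n k)"
  have "?f2 \<in> \<Theta>(\<lambda>n. 1 / (1 * real n) * real n powr (1 / 2))"
    using k pos sym by (intro landau_theta.mult landau_theta.divide sigma_nk_bigtheta half moment_sums_bigtheta nonneg) auto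
  also have "(\<lambda>n. 1 / (1 * real n) * real n powr (1 / 2)) \<in> \<Theta>(\<lambda>n. real n powr (- 1 / 2))"
    by real_asymp
  finally have 2: "?f2 \<in> \<Theta>(\<lambda>n. real n powr (- 1 / 2))" .
  show ?thesis
  proof (rule bigthetaI)
    show "(\<lambda>n. wasserstein_bound n k) \<in> O(\<lambda>n. real n powr (- 1 / 2))"
      unfolding wasserstein_bound_def by (intro sum_in_bigo bigthetaD1 1 2)
    have "(\<lambda>n. wasserstein_bound n k) \<in> \<Omega>(?f2)"
    proof (rule landau_omega.big_mono, rule always_eventually, rule allI)
      fix n
      have "0 \<le> ?f2 n" "0 \<le> 4 * real k ^ 2 / sigma_nk n k ^ 3 * a_nk n k" using nonneg by simp_all
      then show "norm (?f2 n) \<le> norm (wasserstein_bound n k)" by (simp add: wasserstein_bound_def)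
    qed
    also have "?f2 \<in> \<Omega>(\<lambda>n. real n powr (- 1 / 2))" using 2 by (rule bigthetaD2)
    finally show "(\<lambda>n. wasserstein_bound n k) \<in> \<Omega>(\<lambda>n. real n powr (- 1 / 2))" .
  qed
qed

theorem theorem2p14:
  fixes k :: nat and N :: "'b measure" and Z :: "'b \<Rightarrow> real"
  assumes k: "1 \<le> k"
    and N: "prob_space N"
    and Z: "distributed N lborel Z (\<lambda>x. ennreal (std_normal_density x))"
  shows
    "(\<forall>n>k.
        sigma_nk n k > 0
      \<and> a_nk n k = 2 * ((2 ^ (3 * k) - 3 * 2 ^ (2 * k) + 2 ^ (k + 2) - 2) / 2 ^ (4 * k))
          + (real n - real k - 1)
            * ((2 ^ (3 * (k + 1)) - 3 * 2 ^ (2 * (k + 1)) + 2 ^ (k + 3) - 2) / 2 ^ (4 * (k + 1)))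
      \<and> b_nk n k = 2 * ((2 ^ (2 * k) - 3 * 2 ^ k + 3) * (2 ^ k - 1) / 2 ^ (4 * k))
          + (real n - real k - 1)
            * ((2 ^ (2 * (k + 1)) - 3 * 2 ^ (k + 1) + 3) * (2 ^ (k + 1) - 1) / 2 ^ (4 * (k + 1)))
      \<and> wasserstein_dist (measure_pmf (unif_b2 n)) (W_nk n k) N Z \<le> ennreal (wasserstein_bound n k))
     \<and> (\<lambda>n. sigma_nk n k ^ 2) \<in> \<Theta>(\<lambda>n. real n)
     \<and> (\<lambda>n. a_nk n k) \<in> \<Theta>(\<lambda>n. real n)
     \<and> (\<lambda>n. b_nk n k) \<in> \<Theta>(\<lambda>n. real n)
     \<and> (\<lambda>n. wasserstein_bound n k) \<in> \<Theta>(\<lambda>n. real n powr (- 1 / 2))"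
proof (intro conjI allI impI)
  fix n assume kn: "k < n"
  interpret block_model n k using k kn by unfold_locales
  show "sigma_nk n k > 0" using sig2_pos by (simp add: sigma_nk_eq)
  have k3: "k + 3 = k + 1 + 2" by simp
  show "a_nk n k = 2 * ((2 ^ (3 * k) - 3 * 2 ^ (2 * k) + 2 ^ (k + 2) - 2) / 2 ^ (4 * k))
      + (real n - real k - 1)
        * ((2 ^ (3 * (k + 1)) - 3 * 2 ^ (2 * (k + 1)) + 2 ^ (k + 3) - 2) / 2 ^ (4 * (k + 1)))"
    unfolding moment_sums_closed(1)[OF k kn] mu3_def mu3_pow2 k3 ..
  show "b_nk n k = 2 * ((2 ^ (2 * k) - 3 * 2 ^ k + 3) * (2 ^ k - 1) / 2 ^ (4 * k))
      + (real n - real k - 1)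
        * ((2 ^ (2 * (k + 1)) - 3 * 2 ^ (k + 1) + 3) * (2 ^ (k + 1) - 1) / 2 ^ (4 * (k + 1)))"
    unfolding moment_sums_closed(2)[OF k kn] mu4_def mu4_pow2 ..
  show "wasserstein_dist (measure_pmf (unif_b2 n)) (W_nk n k) N Z \<le> ennreal (wasserstein_bound n k)"
    by (rule wasserstein_le[OF Z])
qed (rule sigma_nk_bigtheta[OF k] moment_sums_bigtheta[OF k] wasserstein_bound_bigtheta[OF k])+

end
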